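(* All simple quantum graphs on $M_2$ are quantum Cayley graphs of $\mathbb{Z}_2\times\mathbb{Z}_2$, i.e. every simple quantum graph on $M_2$ is isomorphic to a twisted Cayley graph $\breve{\mathrm{Cay}}(\mathbb{Z}_2\times\mathbb{Z}_2,S)$ for some $S\subseteq\mathbb{Z}_2\times\mathbb{Z}_2$ and some unitary bicharacter on $\mathbb{Z}_2\times\mathbb{Z}_2$. In particular, they are quantum isomorphic to classical graphs.
   Context: **Finite quantum sets and quantum graphs.** A finite quantum set $X$ is a finite-dimensional C*-algebra $C(X)\cong\bigoplus_i M_{n_i}(\mathbb{C})$ with the functional (counit) $\eta^\dag(x)=\sum_i n_i\mathrm{Tr}(x_i)$; $M_2$ is the one with $C(M_2)=M_2(\mathbb{C})$. $l^2(X)$ is $C(X)$ with inner product $\langle a,b\rangle=\eta^\dag(a^*b)$; $m$ is the multiplication, $\eta$ the unit map, $\dag$ denotes Hilbert space adjoints; $mm^\dag=\mathrm{id}$. Put $R^\dag=\eta^\dag m$, $R=m^\dag\eta$. A quantum graph on $X$ is an orthogonal projection $\tilde A\in C(X)\otimes C(X)^{\rm op}$, or equivalently its adjacency matrix $A=(\mathrm{id}\otimes R^\dag)(\tilde A\otimes\mathrm{id})\colon l^2(X)\to l^2(X)$. It is simple if $\tilde A$ is invariant under the swap (undirected) and $\tilde A\tilde I=0$ (no loops), where $\tilde I$ is $R$ viewed in $C(X)\otimes C(X)^{\rm op}$. It is classical if $C(X)$ is commutative, i.e. the algebra of functions on a finite set. Quantum graphs $(X,A_X)$, $(Y,A_Y)$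 are isomorphic if there is a $*$-isomorphism $\phi\colon C(X)\to C(Y)$ with $\phi A_X=A_Y\phi$. **Twisted Cayley graphs.** For a finite abelian group $\Gamma$ (additive, $N=|\Gamma|$) let $\tau_\mu$, $\mu\in\Gamma$, list all irreducible characters with $\tau_\mu\tau_\nu=\tau_{\mu+\nu}$. A unitary bicharacter $\sigma\colon\Gamma\times\Gamma\to\mathbb{T}$ is a map that is a homomorphism in each variable. $C(\breve\Gamma)$ is the C*-algebra with linear basis of unitaries $\breve\tau_\mu$, $\mu\in\Gamma$, with $\breve\tau_0=1$ and $\breve\tau_\mu\breve\tau_\nu=\overline{\sigma(\mu,\nu)}\,\breve\tau_{\mu+\nu}$ and counit $\breve\eta^\dag(\breve\tau_\mu)=N\delta_{\mu,0}$. For $S\subseteq\Gamma$, $\breve{\mathrm{Cay}}(\Gamma,S)$ is the quantum graph with algebra $C(\breve\Gamma)$ and adjacency operator $\breve A\breve\tau_\mu=\lambda_\mu\breve\tau_\mu$, $\lambda_\mu=\sum_{\theta\in S}\tau_\mu(-\theta)$. **Quantum isomorphism.** For an orthonormal basis $(e_i)_{i=1}^N$ of $l^2(X)$ and $F$ with $e_i^*=\sum_jF_i^je_j$, $\mathrm{Aut}^+X$ is the compact matrix quantum group whose $*$-algebra is the universal unital $*$-algebra generated by $u^i_j$ with relations: $u$ unitary, $uF=F\bar u$, $m(u\otimes u)=um$, $Au=uA$ ($[\bar u]^i_j=u^{i*}_j$), and $\Delta(u^i_j)=\sum_ku^i_k\otimes u^k_j$. For $G=\mathrm{Aut}^+X$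 let $\mathfrak{C}_G(k,l)=\{T\mid Tu^{\otimes k}=u^{\otimes l}T\}$, a monoidal $\dag$-category with objects $\mathbb{N}_0$. Quantum graphs $X_1,X_2$ with $G_i=\mathrm{Aut}^+X_i$ are quantum isomorphic if there is a monoidal $\dag$-category isomorphism $\mathfrak{C}_{G_1}\to\mathfrak{C}_{G_2}$ (identity on objects; equivalently a monoidal equivalence $\mathrm{Rep}\,G_1\to\mathrm{Rep}\,G_2$ with $u_1\mapsto u_2$) mapping $A_1\mapsto A_2$ (and, as understood, $m_1\mapsto m_2$, $\eta_1\mapsto\eta_2$). *)

theory Defs
  imports "HOL-Analysis.Analysis" "HOL-Library.Poly_Mapping"
begin

section \<open>Finite quantum sets\<close>

text \<open>The vector space underlying \<open>C(X)\<close> is \<open>complex ^ 'i\<close>; the product, unit, involution and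
  counit are carried by a record. The coordinates with respect to \<open>axis i 1\<close> have no
  significance: this basis need be neither orthogonal nor normalised.\<close>

record 'i qset =
  qmult :: "complex ^ 'i \<Rightarrow> complex ^ 'i \<Rightarrow> complex ^ 'i"
  qone :: "complex ^ 'i"
  qstar :: "complex ^ 'i \<Rightarrow> complex ^ 'i"
  qcounit :: "complex ^ 'i \<Rightarrow> complex"

text \<open>The multimatrix algebra \<open>\<Oplus>\<^bsub>i < r\<^esub> M\<^bsub>n i\<^esub>(\<complex>)\<close>: \<open>M i a b\<close> is the entry \<open>(a, b)\<close> of the
  \<open>i\<close>-th block, and all entries outside the blocks are \<open>0\<close>.\<close>

type_synonym blocks = "nat \<Rightarrow> nat \<Rightarrow> nat \<Rightarrow> complex"

definition multimatrix :: "nat \<Rightarrow> (nat \<Rightarrow> nat) \<Rightarrow> blocks set" where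
  "multimatrix r n = {M. \<forall>i a b. M i a b \<noteq> 0 \<longrightarrow> i < r \<and> a < n i \<and> b < n i}"

definition block_one :: "nat \<Rightarrow> (nat \<Rightarrow> nat) \<Rightarrow> blocks" where
  "block_one r n = (\<lambda>i a b. if i < r \<and> a < n i \<and> a = b then 1 else 0)"

definition block_mult :: "(nat \<Rightarrow> nat) \<Rightarrow> blocks \<Rightarrow> blocks \<Rightarrow> blocks" where
  "block_mult n M K = (\<lambda>i a b. \<Sum>c<n i. M i a c * K i c b)"

definition block_adjoint :: "blocks \<Rightarrow> blocks" where
  "block_adjoint M = (\<lambda>i a b. cnj (M i b a))"

definition block_counit :: "nat \<Rightarrow> (nat \<Rightarrow> nat) \<Rightarrow> blocks \<Rightarrow> complex" where
  "block_counit r n M = (\<Sum>i<r. of_nat (n i) * (\<Sum>a<n i. M i a a))"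

definition finite_quantum_set :: "'i::finite qset \<Rightarrow> bool" where
  "finite_quantum_set X \<longleftrightarrow> (\<exists>r n \<phi>.
     (\<forall>i<r. 0 < n i) \<and>
     bij_betw \<phi> UNIV (multimatrix r n) \<and>
     (\<forall>x y. \<phi> (x + y) = (\<lambda>i a b. \<phi> x i a b + \<phi> y i a b)) \<and>
     (\<forall>c x. \<phi> (c *s x) = (\<lambda>i a b. c * \<phi> x i a b)) \<and>
     (\<forall>x y. \<phi> (qmult X x y) = block_mult n (\<phi> x) (\<phi> y)) \<and>
     \<phi> (qone X) = block_one r n \<and>
     (\<forall>x. \<phi> (qstar X x) = block_adjoint (\<phi> x)) \<and>
     (\<forall>x. qcounit X x = block_counit r n (\<phi> x)))"

definition classical :: "'i::finite qset \<Rightarrow> bool" where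
  "classical X \<longleftrightarrow> (\<forall>x y. qmult X x y = qmult X y x)"

text \<open>The matrix with entries \<open>x\<^sub>a\<^sub>b\<close> is the vector with coordinate \<open>x\<^sub>a\<^sub>b\<close> at \<open>(a, b) :: 2 \<times> 2\<close>.\<close>

definition M2 :: "(2 \<times> 2) qset" where
  "M2 = \<lparr> qmult = (\<lambda>x y. \<chi> p. \<Sum>c\<in>UNIV. x $ (fst p, c) * y $ (c, snd p)),
          qone = (\<chi> p. if fst p = snd p then 1 else 0),
          qstar = (\<lambda>x. \<chi> p. cnj (x $ (snd p, fst p))),
          qcounit = (\<lambda>x. 2 * (\<Sum>a\<in>UNIV. x $ (a, a))) \<rparr>"


section \<open>The Hilbert space \<open>l\<^sup>2(X)\<close>\<close>

definition qinner :: "'i::finite qset \<Rightarrow> complex ^ 'i \<Rightarrow> complex ^ 'i \<Rightarrow> complex" where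
  "qinner X x y = qcounit X (qmult X (qstar X x) y)"

text \<open>\<open>l\<^sup>2(X) \<otimes> l\<^sup>2(X)\<close> is \<open>complex ^ ('i \<times> 'i)\<close>, with \<open>axis (i, j) 1\<close> standing for
  \<open>axis i 1 \<otimes> axis j 1\<close>.\<close>

definition tensor_inner ::
    "'i::finite qset \<Rightarrow> complex ^ ('i \<times> 'i) \<Rightarrow> complex ^ ('i \<times> 'i) \<Rightarrow> complex" where
  "tensor_inner X S T = (\<Sum>p\<in>UNIV. \<Sum>q\<in>UNIV. cnj (S $ p) * T $ q *
     qinner X (axis (fst p) 1) (axis (fst q) 1) * qinner X (axis (snd p) 1) (axis (snd q) 1))"

definition tensor_mult :: "'i::finite qset \<Rightarrow> complex ^ ('i \<times> 'i) \<Rightarrow> complex ^ 'i" where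
  "tensor_mult X T = (\<Sum>p\<in>UNIV. T $ p *s qmult X (axis (fst p) 1) (axis (snd p) 1))"

text \<open>Hilbert space adjoint of \<open>f\<close> with respect to the inner products \<open>ip\<close> on the domain and
  \<open>ip'\<close> on the codomain.\<close>

definition hilbert_adjoint ::
    "('a \<Rightarrow> 'a \<Rightarrow> complex) \<Rightarrow> ('b \<Rightarrow> 'b \<Rightarrow> complex) \<Rightarrow> ('a \<Rightarrow> 'b) \<Rightarrow> 'b \<Rightarrow> 'a" where
  "hilbert_adjoint ip ip' f = (THE g. \<forall>x y. ip' (f x) y = ip x (g y))"

text \<open>\<open>R = m\<^sup>\<dagger>\<eta>\<close>, identified with its value at \<open>1 \<in> \<complex>\<close>; read as an element of
  \<open>C(X) \<otimes> C(X)\<^sup>o\<^sup>p\<close> it is \<open>\<tilde>I\<close>.\<close>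

definition loop_projection :: "'i::finite qset \<Rightarrow> complex ^ ('i \<times> 'i)" where
  "loop_projection X =
     hilbert_adjoint (tensor_inner X) (qinner X) (tensor_mult X) (qone X)"

definition orthonormal_basis :: "'i::finite qset \<Rightarrow> ('i \<Rightarrow> complex ^ 'i) \<Rightarrow> bool" where
  "orthonormal_basis X e \<longleftrightarrow>
     (\<forall>i j. qinner X (e i) (e j) = (if i = j then 1 else 0)) \<and> vec.span (range e) = UNIV"


section \<open>Quantum graphs\<close>

text \<open>Product and involution of \<open>C(X) \<otimes> C(X)\<^sup>o\<^sup>p\<close>, bilinearly and antilinearly extended from
  \<open>(a \<otimes> b)(c \<otimes> d) = ac \<otimes> db\<close> and \<open>(a \<otimes> b)\<^sup>* = a\<^sup>* \<otimes> b\<^sup>*\<close>.\<close>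

definition pure_tensor :: "complex ^ 'i::finite \<Rightarrow> complex ^ 'i \<Rightarrow> complex ^ ('i \<times> 'i)" where
  "pure_tensor x y = (\<chi> p. x $ fst p * y $ snd p)"

definition env_mult ::
    "'i::finite qset \<Rightarrow> complex ^ ('i \<times> 'i) \<Rightarrow> complex ^ ('i \<times> 'i) \<Rightarrow> complex ^ ('i \<times> 'i)" where
  "env_mult X S T = (\<Sum>p\<in>UNIV. \<Sum>q\<in>UNIV. (S $ p * T $ q) *s
     pure_tensor (qmult X (axis (fst p) 1) (axis (fst q) 1))
                 (qmult X (axis (snd q) 1) (axis (snd p) 1)))"

definition env_star :: "'i::finite qset \<Rightarrow> complex ^ ('i \<times> 'i) \<Rightarrow> complex ^ ('i \<times> 'i)" where
  "env_star X S = (\<Sum>p\<in>UNIV. cnj (S $ p) *s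
     pure_tensor (qstar X (axis (fst p) 1)) (qstar X (axis (snd p) 1)))"

definition tensor_swap :: "complex ^ ('i::finite \<times> 'i) \<Rightarrow> complex ^ ('i \<times> 'i)" where
  "tensor_swap S = (\<chi> p. S $ (snd p, fst p))"

definition env_projection :: "'i::finite qset \<Rightarrow> complex ^ ('i \<times> 'i) \<Rightarrow> bool" where
  "env_projection X P \<longleftrightarrow> env_mult X P P = P \<and> env_star X P = P"

text \<open>\<open>(id \<otimes> R\<^sup>\<dagger>)(P \<otimes> id)\<close> with \<open>R\<^sup>\<dagger> = \<eta>\<^sup>\<dagger>m\<close>: for \<open>P = \<Sum> a \<otimes> b\<close> it maps \<open>x\<close> to \<open>\<Sum> \<eta>\<^sup>\<dagger>(bx) a\<close>.\<close>

definition adjacency ::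
    "'i::finite qset \<Rightarrow> complex ^ ('i \<times> 'i) \<Rightarrow> complex ^ 'i \<Rightarrow> complex ^ 'i" where
  "adjacency X P x =
     (\<Sum>p\<in>UNIV. (P $ p * qcounit X (qmult X (axis (snd p) 1) x)) *s axis (fst p) 1)"

text \<open>A quantum graph is presented as a pair \<open>(X, A)\<close> with \<open>A\<close> the adjacency matrix.\<close>

definition quantum_graph ::
    "'i::finite qset \<Rightarrow> (complex ^ 'i \<Rightarrow> complex ^ 'i) \<Rightarrow> bool" where
  "quantum_graph X A \<longleftrightarrow>
     finite_quantum_set X \<and> (\<exists>P. env_projection X P \<and> A = adjacency X P)"

definition simple_quantum_graph ::
    "'i::finite qset \<Rightarrow> (complex ^ 'i \<Rightarrow> complex ^ 'i) \<Rightarrow> bool" where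
  "simple_quantum_graph X A \<longleftrightarrow>
     finite_quantum_set X \<and>
     (\<exists>P. env_projection X P \<and> A = adjacency X P \<and>
          tensor_swap P = P \<and> env_mult X P (loop_projection X) = 0)"

definition qgraph_isomorphic ::
    "'i::finite qset \<Rightarrow> (complex ^ 'i \<Rightarrow> complex ^ 'i) \<Rightarrow>
     'j::finite qset \<Rightarrow> (complex ^ 'j \<Rightarrow> complex ^ 'j) \<Rightarrow> bool" where
  "qgraph_isomorphic X A Y B \<longleftrightarrow> (\<exists>\<phi>.
     Vector_Spaces.linear (*s) (*s) \<phi> \<and> bij \<phi> \<and>
     (\<forall>x y. \<phi> (qmult X x y) = qmult Y (\<phi> x) (\<phi> y)) \<and>
     (\<forall>x. \<phi> (qstar X x) = qstar Y (\<phi> x)) \<and>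
     \<phi> \<circ> A = B \<circ> \<phi>)"


section \<open>Twisted Cayley graphs\<close>

definition unitary_bicharacter :: "('g::ab_group_add \<Rightarrow> 'g \<Rightarrow> complex) \<Rightarrow> bool" where
  "unitary_bicharacter \<sigma> \<longleftrightarrow>
     (\<forall>x y. norm (\<sigma> x y) = 1) \<and>
     (\<forall>x y z. \<sigma> (x + y) z = \<sigma> x z * \<sigma> y z) \<and>
     (\<forall>x y z. \<sigma> x (y + z) = \<sigma> x y * \<sigma> x z)"

text \<open>The irreducible characters of a finite abelian group are its homomorphisms to the circle.\<close>

definition character_labelling :: "('g::ab_group_add \<Rightarrow> 'g \<Rightarrow> complex) \<Rightarrow> bool" where
  "character_labelling \<tau> \<longleftrightarrow>
     bij_betw \<tau> UNIV {f. (\<forall>x. norm (f x) = 1) \<and> (\<forall>x y. f (x + y) = f x * f y)} \<and>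
     (\<forall>\<mu> \<nu> x. \<tau> \<mu> x * \<tau> \<nu> x = \<tau> (\<mu> + \<nu>) x)"

text \<open>\<open>axis \<mu> 1\<close> is the basis unitary \<open>t\<^sub>\<mu>\<close>. Unitarity of \<open>t\<^sub>\<mu>\<close> and
  \<open>t\<^sub>\<mu> t\<^bsub>-\<mu>\<^esub> = cnj (\<sigma>(\<mu>, -\<mu>)) t\<^sub>0\<close> force \<open>t\<^sub>\<mu>\<^sup>* = \<sigma>(\<mu>, -\<mu>) t\<^bsub>-\<mu>\<^esub>\<close>.\<close>

definition twisted_dual :: "('g::{finite, ab_group_add} \<Rightarrow> 'g \<Rightarrow> complex) \<Rightarrow> 'g qset" where
  "twisted_dual \<sigma> =
    \<lparr> qmult = (\<lambda>x y. \<Sum>\<mu>\<in>UNIV. \<Sum>\<nu>\<in>UNIV. (x $ \<mu> * y $ \<nu> * cnj (\<sigma> \<mu> \<nu>)) *s axis (\<mu> + \<nu>) 1),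
      qone = axis 0 1,
      qstar = (\<lambda>x. \<Sum>\<mu>\<in>UNIV. (cnj (x $ \<mu>) * \<sigma> \<mu> (- \<mu>)) *s axis (- \<mu>) 1),
      qcounit = (\<lambda>x. of_nat CARD('g) * x $ 0) \<rparr>"

definition cayley_adjacency ::
    "('g \<Rightarrow> 'g \<Rightarrow> complex) \<Rightarrow> 'g set \<Rightarrow>
     complex ^ 'g::{finite, ab_group_add} \<Rightarrow> complex ^ 'g::{finite, ab_group_add}" where
  "cayley_adjacency \<tau> S x = (\<chi> \<mu>. (\<Sum>\<theta>\<in>S. \<tau> \<mu> (- \<theta>)) * x $ \<mu>)"


section \<open>The quantum automorphism group\<close>

text \<open>The free unital \<open>*\<close>-algebra on the \<open>u\<^sup>i\<^sub>j\<close> is the monoid algebra of the free monoid on the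
  letters \<open>u\<^sup>i\<^sub>j\<close> (\<open>Gen i j\<close>) and \<open>(u\<^sup>i\<^sub>j)\<^sup>*\<close> (\<open>GenStar i j\<close>). The free monoid is written additively
  because the convolution product of \<^typ>\<open>'a \<Rightarrow>\<^sub>0 'b\<close> asks for \<^class>\<open>monoid_add\<close>.\<close>

datatype 'i letter = Gen 'i 'i | GenStar 'i 'i

datatype 'a word = Word "'a list"

instantiation word :: (type) monoid_add
begin

definition zero_word :: "'a word" where
  "0 = Word []"

fun plus_word :: "'a word \<Rightarrow> 'a word \<Rightarrow> 'a word" where
  "Word v + Word w = Word (v @ w)"

instance
proof
  fix a b c :: "'a word"
  show "a + b + c = a + (b + c)" by (cases a; cases b; cases c) simp
  show "0 + a = a" by (cases a) (simp add: zero_word_def)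
  show "a + 0 = a" by (cases a) (simp add: zero_word_def)
qed

end

type_synonym 'i free_alg = "'i letter word \<Rightarrow>\<^sub>0 complex"

fun letter_star :: "'i letter \<Rightarrow> 'i letter" where
  "letter_star (Gen i j) = GenStar i j"
| "letter_star (GenStar i j) = Gen i j"

fun word_star :: "'i letter word \<Rightarrow> 'i letter word" where
  "word_star (Word w) = Word (rev (map letter_star w))"

definition free_star :: "'i free_alg \<Rightarrow> 'i free_alg" where
  "free_star p =
     (\<Sum>w\<in>Poly_Mapping.keys p. Poly_Mapping.single (word_star w) (cnj (Poly_Mapping.lookup p w)))"

definition scalar :: "complex \<Rightarrow> 'i free_alg" where
  "scalar c = Poly_Mapping.single 0 c"

definition gen :: "'i \<Rightarrow> 'i \<Rightarrow> 'i free_alg" where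
  "gen i j = Poly_Mapping.single (Word [Gen i j]) 1"

definition gen_star :: "'i \<Rightarrow> 'i \<Rightarrow> 'i free_alg" where
  "gen_star i j = Poly_Mapping.single (Word [GenStar i j]) 1"

inductive_set star_ideal :: "'i free_alg set \<Rightarrow> 'i free_alg set" for Rel where
  base: "p \<in> Rel \<Longrightarrow> p \<in> star_ideal Rel"
| zero: "0 \<in> star_ideal Rel"
| add: "p \<in> star_ideal Rel \<Longrightarrow> q \<in> star_ideal Rel \<Longrightarrow> p + q \<in> star_ideal Rel"
| mult_left: "p \<in> star_ideal Rel \<Longrightarrow> a * p \<in> star_ideal Rel"
| mult_right: "p \<in> star_ideal Rel \<Longrightarrow> p * a \<in> star_ideal Rel"
| star: "p \<in> star_ideal Rel \<Longrightarrow> free_star p \<in> star_ideal Rel"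

text \<open>Matrices with respect to an orthonormal basis \<open>e\<close>. Operators between tensor powers of
  \<open>l\<^sup>2(X)\<close> are matrices indexed by lists of basis labels: for \<open>T : l\<^sup>2(X)\<^sup>\<otimes>\<^sup>k \<rightarrow> l\<^sup>2(X)\<^sup>\<otimes>\<^sup>l\<close>, row indices
  have length \<open>l\<close>, column indices have length \<open>k\<close>, and all other entries are \<open>0\<close>.\<close>

type_synonym 'i tmatrix = "'i list \<Rightarrow> 'i list \<Rightarrow> complex"

fun op_matrix ::
    "'i::finite qset \<Rightarrow> ('i \<Rightarrow> complex ^ 'i) \<Rightarrow> (complex ^ 'i \<Rightarrow> complex ^ 'i) \<Rightarrow> 'i tmatrix" where
  "op_matrix X e A [i] [j] = qinner X (e i) (A (e j))"
| "op_matrix X e A _ _ = 0"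

fun mult_matrix :: "'i::finite qset \<Rightarrow> ('i \<Rightarrow> complex ^ 'i) \<Rightarrow> 'i tmatrix" where
  "mult_matrix X e [k] [i, j] = qinner X (e k) (qmult X (e i) (e j))"
| "mult_matrix X e _ _ = 0"

fun unit_matrix :: "'i::finite qset \<Rightarrow> ('i \<Rightarrow> complex ^ 'i) \<Rightarrow> 'i tmatrix" where
  "unit_matrix X e [i] [] = qinner X (e i) (qone X)"
| "unit_matrix X e _ _ = 0"

text \<open>\<open>star_matrix X e j i\<close> is \<open>F\<^sub>i\<^sup>j\<close> in \<open>e\<^sub>i\<^sup>* = \<Sum>\<^sub>j F\<^sub>i\<^sup>j e\<^sub>j\<close>; as for \<open>u\<^sup>i\<^sub>j\<close>, the upper index is the
  row.\<close>

definition star_matrix :: "'i::finite qset \<Rightarrow> ('i \<Rightarrow> complex ^ 'i) \<Rightarrow> 'i \<Rightarrow> 'i \<Rightarrow> complex" where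
  "star_matrix X e j i = qinner X (e j) (qstar X (e i))"

text \<open>Entrywise, in this order: \<open>uu\<^sup>* = 1\<close>, \<open>u\<^sup>*u = 1\<close>, \<open>uF = F\<bar>u\<close>, \<open>m(u \<otimes> u) = um\<close>, \<open>Au = uA\<close>.\<close>

definition aut_relations ::
    "'i::finite qset \<Rightarrow> (complex ^ 'i \<Rightarrow> complex ^ 'i) \<Rightarrow> ('i \<Rightarrow> complex ^ 'i) \<Rightarrow> 'i free_alg set" where
  "aut_relations X A e =
     {(\<Sum>k\<in>UNIV. gen i k * gen_star j k) - scalar (if i = j then 1 else 0) | i j. True} \<union>
     {(\<Sum>k\<in>UNIV. gen_star k i * gen k j) - scalar (if i = j then 1 else 0) | i j. True} \<union>
     {(\<Sum>k\<in>UNIV. gen i k * scalar (star_matrix X e k j))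
        - (\<Sum>k\<in>UNIV. scalar (star_matrix X e i k) * gen_star k j) | i j. True} \<union>
     {(\<Sum>a\<in>UNIV. \<Sum>b\<in>UNIV. scalar (mult_matrix X e [k] [a, b]) * gen a i * gen b j)
        - (\<Sum>c\<in>UNIV. gen k c * scalar (mult_matrix X e [c] [i, j])) | k i j. True} \<union>
     {(\<Sum>k\<in>UNIV. scalar (op_matrix X e A [i] [k]) * gen k j)
        - (\<Sum>k\<in>UNIV. gen i k * scalar (op_matrix X e A [k] [j])) | i j. True}"

text \<open>The \<open>*\<close>-algebra of \<open>Aut\<^sup>+\<close> is the quotient of the free \<open>*\<close>-algebra by this ideal. The
  comultiplication does not enter the intertwiner spaces.\<close>

definition aut_ideal ::
    "'i::finite qset \<Rightarrow> (complex ^ 'i \<Rightarrow> complex ^ 'i) \<Rightarrow> ('i \<Rightarrow> complex ^ 'i) \<Rightarrow> 'i free_alg set" where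
  "aut_ideal X A e = star_ideal (aut_relations X A e)"

definition tensor_power_entry :: "'i list \<Rightarrow> 'i list \<Rightarrow> 'i free_alg" where
  "tensor_power_entry a b = prod_list (map2 gen a b)"

definition intertwiners ::
    "'i::finite qset \<Rightarrow> (complex ^ 'i \<Rightarrow> complex ^ 'i) \<Rightarrow> ('i \<Rightarrow> complex ^ 'i) \<Rightarrow>
     nat \<Rightarrow> nat \<Rightarrow> 'i tmatrix set" where
  "intertwiners X A e k l = {T.
     (\<forall>a b. T a b \<noteq> 0 \<longrightarrow> length a = l \<and> length b = k) \<and>
     (\<forall>a b. length a = l \<longrightarrow> length b = k \<longrightarrow>
        (\<Sum>c | length c = k. scalar (T a c) * tensor_power_entry c b)
        - (\<Sum>d | length d = l. tensor_power_entry a d * scalar (T d b)) \<in> aut_ideal X A e)}"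


section \<open>Quantum isomorphism\<close>

definition tid :: "nat \<Rightarrow> 'i tmatrix" where
  "tid k = (\<lambda>a b. if length a = k \<and> a = b then 1 else 0)"

definition tcomp :: "nat \<Rightarrow> 'i tmatrix \<Rightarrow> 'i tmatrix \<Rightarrow> 'i tmatrix" where
  "tcomp l T S = (\<lambda>a b. \<Sum>c | length c = l. T a c * S c b)"

definition ttensor :: "nat \<Rightarrow> nat \<Rightarrow> 'i tmatrix \<Rightarrow> 'i tmatrix \<Rightarrow> 'i tmatrix" where
  "ttensor k l T S = (\<lambda>a b. T (take l a) (take k b) * S (drop l a) (drop k b))"

definition tdagger :: "'i tmatrix \<Rightarrow> 'i tmatrix" where
  "tdagger T = (\<lambda>a b. cnj (T b a))"

text \<open>Monoidal \<open>\<dagger>\<close>-isomorphisms that are the identity on the objects \<open>0, 1, 2, \<dots>\<close>, for categories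
  of matrices with \<open>C k l\<close> the space of morphisms from \<open>k\<close> to \<open>l\<close>. As always for representation
  categories, the functors are complex linear on morphism spaces.\<close>

definition monoidal_dagger_iso ::
    "(nat \<Rightarrow> nat \<Rightarrow> 'i::finite tmatrix set) \<Rightarrow> (nat \<Rightarrow> nat \<Rightarrow> 'j::finite tmatrix set) \<Rightarrow>
     (nat \<Rightarrow> nat \<Rightarrow> 'i tmatrix \<Rightarrow> 'j tmatrix) \<Rightarrow> bool" where
  "monoidal_dagger_iso C D \<Phi> \<longleftrightarrow>
     (\<forall>k l. bij_betw (\<Phi> k l) (C k l) (D k l)) \<and>
     (\<forall>k l. \<forall>S\<in>C k l. \<forall>T\<in>C k l.
        \<Phi> k l (\<lambda>a b. S a b + T a b) = (\<lambda>a b. \<Phi> k l S a b + \<Phi> k l T a b)) \<and>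
     (\<forall>k l z. \<forall>T\<in>C k l. \<Phi> k l (\<lambda>a b. z * T a b) = (\<lambda>a b. z * \<Phi> k l T a b)) \<and>
     (\<forall>k. \<Phi> k k (tid k) = tid k) \<and>
     (\<forall>k l n. \<forall>S\<in>C k l. \<forall>T\<in>C l n. \<Phi> k n (tcomp l T S) = tcomp l (\<Phi> l n T) (\<Phi> k l S)) \<and>
     (\<forall>k l k' l'. \<forall>S\<in>C k l. \<forall>T\<in>C k' l'.
        \<Phi> (k + k') (l + l') (ttensor k l S T) = ttensor k l (\<Phi> k l S) (\<Phi> k' l' T)) \<and>
     (\<forall>k l. \<forall>T\<in>C k l. \<Phi> l k (tdagger T) = tdagger (\<Phi> k l T))"

text \<open>The orthonormal bases only serve to write the intertwiners as matrices; a change of basis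
  is a unitary conjugation, which induces an isomorphism of the resulting categories, so it is
  immaterial which bases are taken.\<close>

definition quantum_isomorphic ::
    "'i::finite qset \<Rightarrow> (complex ^ 'i \<Rightarrow> complex ^ 'i) \<Rightarrow>
     'j::finite qset \<Rightarrow> (complex ^ 'j \<Rightarrow> complex ^ 'j) \<Rightarrow> bool" where
  "quantum_isomorphic X A Y B \<longleftrightarrow> (\<exists>e f \<Phi>.
     orthonormal_basis X e \<and> orthonormal_basis Y f \<and>
     monoidal_dagger_iso (intertwiners X A e) (intertwiners Y B f) \<Phi> \<and>
     \<Phi> 1 1 (op_matrix X e A) = op_matrix Y f B \<and>
     \<Phi> 2 1 (mult_matrix X e) = mult_matrix Y f \<and>
     \<Phi> 0 1 (unit_matrix X e) = unit_matrix Y f)"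

end

theory Submission
  imports Defs
begin

text \<open>An element \<open>P = \<Sum> a \<otimes> b\<close> of \<open>M\<^sub>2 \<otimes> M\<^sub>2\<^sup>o\<^sup>p\<close> acts on \<open>M\<^sub>2\<close> by \<open>x \<mapsto> \<Sum> a x b\<close>. Under this action the
  defining conditions of a simple quantum graph become geometric: a projection is an orthogonal
  projection of \<open>M\<^sub>2\<close>, invariance under the swap says that it commutes with the involution, and absence of
  loops says that it kills \<open>1\<close>. Such an operator preserves the real space of traceless self-adjoint
  matrices, a copy of \<open>\<real>\<^sup>3\<close> spanned by the Pauli matrices, and is determined by the orthogonal
  projection \<open>Q\<close> that it induces there. For an orthonormal basis \<open>v\<^sub>1, v\<^sub>2, v\<^sub>3\<close> of \<open>\<real>\<^sup>3\<close> consisting of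
  eigenvectors of \<open>Q\<close>, with corresponding matrices \<open>V\<^sub>1, V\<^sub>2, V\<^sub>3\<close>, the adjacency matrix is
  \<open>A x = \<Sum> V\<^sub>k x V\<^sub>k\<close>, the sum running over the \<open>k\<close> with \<open>Q v\<^sub>k = v\<^sub>k\<close>
  (\<open>simple_quantum_graph_M2_pauli_form\<close>).

  The \<open>V\<^sub>k\<close> are self-adjoint, square to \<open>1\<close> and anticommute. Hence \<open>1, V\<^sub>1, V\<^sub>2, V\<^sub>2 V\<^sub>1\<close>, labelled by the
  Klein four-group, multiply as the basis unitaries of a twisted dual do
  (\<open>twisted_unitary_basis_clifford\<close>), and conjugation by \<open>V\<^sub>k\<close> multiplies each of them by a sign that is
  a character of the label. Every sign character has the form \<open>\<mu> \<mapsto> \<tau>\<^sub>\<mu>(-\<theta>)\<close>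
  (\<open>character_labelling_klein_sign\<close>), so the eigenvalues of \<open>A\<close> are those of a Cayley graph.

  The category isomorphism behind the quantum isomorphism is an explicit cocycle twist. If two quantum graphs have orthonormal bases
  labelled by the same group with structure constants that differ only by the bicharacter, then
  multiplying monomials in the generators \<open>u\<^sup>i\<^sub>j\<close> by suitable phases carries the relations of one quantum
  automorphism group to multiples of the relations of the other (\<open>twist_relations\<close>), and therefore
  the ideal of the one into the ideal of the other (\<open>star_ideal_transfer\<close>). On intertwiners this is
  conjugation by diagonal unitary matrices, which is compatible with composition and adjoints at
  once. Compatibility with tensor products holds because intertwiners preserve the degree
  (\<open>intertwiner_graded\<close>): the dual group acts on both graphs by automorphisms. This gives
  \<open>quantum_isomorphic_if_twisted_frames\<close>, which is applied to \<open>M\<^sub>2\<close> and to the untwisted, hence classical,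
  Cayley graph with the same eigenvalues.\<close>

section \<open>Weighted linear maps between free algebras\<close>

definition weighted_map ::
    "('a \<Rightarrow> complex) \<Rightarrow> ('a \<Rightarrow> 'b) \<Rightarrow> ('a \<Rightarrow>\<^sub>0 complex) \<Rightarrow> ('b \<Rightarrow>\<^sub>0 complex)" where
  "weighted_map \<psi> f p =
     (\<Sum>w\<in>Poly_Mapping.keys p. Poly_Mapping.single (f w) (Poly_Mapping.lookup p w * \<psi> w))"

lemma sum_keys_superset:
  fixes p :: "'a \<Rightarrow>\<^sub>0 'c::zero"
  assumes "finite V" and "Poly_Mapping.keys p \<subseteq> V"
    and "\<And>w. g w 0 = (0 :: 'b::comm_monoid_add)"
  shows "(\<Sum>w\<in>Poly_Mapping.keys p. g w (Poly_Mapping.lookup p w)) =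
         (\<Sum>w\<in>V. g w (Poly_Mapping.lookup p w))"
  using assms by (intro sum.mono_neutral_left) (auto simp: in_keys_iff)

lemma sum_keys_add:
  fixes p q :: "'a \<Rightarrow>\<^sub>0 'c::comm_monoid_add"
  assumes "\<And>w. g w 0 = (0 :: 'b::comm_monoid_add)"
    and "\<And>w x y. g w (x + y) = g w x + g w y"
  shows "(\<Sum>w\<in>Poly_Mapping.keys (p + q). g w (Poly_Mapping.lookup (p + q) w)) =
         (\<Sum>w\<in>Poly_Mapping.keys p. g w (Poly_Mapping.lookup p w)) +
         (\<Sum>w\<in>Poly_Mapping.keys q. g w (Poly_Mapping.lookup q w))"
proof -
  let ?V = "Poly_Mapping.keys p \<union> Poly_Mapping.keys q"
  have "Poly_Mapping.keys (p + q) \<subseteq> ?V" by (rule Poly_Mapping.keys_add)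
  then show ?thesis
    using sum_keys_superset[of ?V "p + q" g] sum_keys_superset[of ?V p g]
      sum_keys_superset[of ?V q g] assms
    by (simp add: lookup_add sum.distrib)
qed

lemma weighted_map_single [simp]:
  "weighted_map \<psi> f (Poly_Mapping.single w c) = Poly_Mapping.single (f w) (c * \<psi> w)"
  by (cases "c = 0") (auto simp: weighted_map_def)

lemma weighted_map_zero [simp]: "weighted_map \<psi> f 0 = 0"
  by (simp add: weighted_map_def)

lemma weighted_map_add: "weighted_map \<psi> f (p + q) = weighted_map \<psi> f p + weighted_map \<psi> f q"
  unfolding weighted_map_def
  by (rule sum_keys_add[where g = "\<lambda>w c. Poly_Mapping.single (f w) (c * \<psi> w)"])
     (simp_all add: single_add algebra_simps)

lemma weighted_map_sum: "weighted_map \<psi> f (\<Sum>i\<in>I. p i) = (\<Sum>i\<in>I. weighted_map \<psi> f (p i))"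
  by (induction I rule: infinite_finite_induct) (simp_all add: weighted_map_add)

lemma weighted_map_diff: "weighted_map \<psi> f (p - q) = weighted_map \<psi> f p - weighted_map \<psi> f q"
  using weighted_map_add[of \<psi> f "p - q" q] by (simp add: eq_diff_eq)

lemma poly_mapping_single_induct [case_names zero add]:
  fixes p :: "'a \<Rightarrow>\<^sub>0 'b::comm_monoid_add"
  assumes "P 0" and "\<And>w c q. P q \<Longrightarrow> P (Poly_Mapping.single w c + q)"
  shows "P p"
proof (induction p rule: update_induct)
  case const
  then show ?case using assms(1) by simp
next
  case (update q w c)
  have "Poly_Mapping.update w c q = Poly_Mapping.single w c + q"
    using update(1)
    by (intro poly_mapping_eqI) (auto simp: lookup_update lookup_add lookup_single in_keys_iff when_def)
  then show ?case using assms(2) update by simp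
qed

lemma free_star_single [simp]:
  "free_star (Poly_Mapping.single w c) = Poly_Mapping.single (word_star w) (cnj c)"
  by (cases "c = 0") (auto simp: free_star_def)

lemma free_star_zero [simp]: "free_star 0 = 0"
  by (simp add: free_star_def)

lemma free_star_add: "free_star (p + q) = free_star p + free_star q"
  unfolding free_star_def
  by (rule sum_keys_add[where g = "\<lambda>w c. Poly_Mapping.single (word_star w) (cnj c)"])
     (simp_all add: single_add)

lemma star_ideal_scale:
  "p \<in> star_ideal R \<Longrightarrow> scalar z * p \<in> star_ideal R"
  by (rule star_ideal.mult_left)

text \<open>A linear map that multiplies words only up to a \<open>2\<close>-cocycle \<open>c\<close> of their degrees does not
  respect ideals in an evident way: for \<open>p\<close> not homogeneous, the image of \<open>a * p\<close> is no multiple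
  of the image of \<open>p\<close>. It is a multiple of the image of \<open>p\<close> reweighted by a function of the degree,
  so the induction over the ideal goes through once all reweightings \<open>h\<close> are admitted at once.
  Allowing arbitrary functions \<open>h\<close> replaces the decomposition of \<open>p\<close> into homogeneous parts.\<close>

lemma star_ideal_transfer:
  fixes f :: "'i letter word \<Rightarrow> 'j letter word"
    and deg :: "'i letter word \<Rightarrow> 'g::ab_group_add"
  assumes deg_add: "\<And>v w. deg (v + w) = deg v + deg w"
    and f_add: "\<And>v w. f (v + w) = f v + f w"
    and weight_add: "\<And>v w. \<psi> (v + w) = c (deg v) (deg w) * \<psi> v * \<psi> w"
    and deg_star: "\<And>w. deg (word_star w) = - deg w"
    and f_star: "\<And>w. f (word_star w) = word_star (f w)"
    and weight_star: "\<And>w. \<psi> (word_star w) = s (deg w) * cnj (\<psi> w)"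
    and rel: "\<And>p h. p \<in> R \<Longrightarrow> weighted_map (\<lambda>w. h (deg w) * \<psi> w) f p \<in> star_ideal R'"
    and p: "p \<in> star_ideal R"
  shows "weighted_map (\<lambda>w. h (deg w) * \<psi> w) f p \<in> star_ideal R'"
  using p
proof (induction arbitrary: h rule: star_ideal.induct)
  case (base p)
  then show ?case by (rule rel)
next
  case zero
  show ?case by (simp add: star_ideal.zero)
next
  case (add p q)
  then show ?case by (simp add: weighted_map_add star_ideal.add)
next
  case (mult_left p a)
  have single: "weighted_map (\<lambda>w. h (deg w) * \<psi> w) f (Poly_Mapping.single v x * q) =
      Poly_Mapping.single (f v) (x * \<psi> v) *
      weighted_map (\<lambda>w. h (deg v + deg w) * c (deg v) (deg w) * \<psi> w) f q" for v x q
    by (induction q rule: poly_mapping_single_induct)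
       (simp_all add: weighted_map_add distrib_left mult_single f_add weight_add deg_add algebra_simps)
  show ?case
  proof (induction a rule: poly_mapping_single_induct)
    case zero
    show ?case by (simp add: star_ideal.zero)
  next
    case (add v x a)
    have "Poly_Mapping.single (f v) (x * \<psi> v) *
        weighted_map (\<lambda>w. h (deg v + deg w) * c (deg v) (deg w) * \<psi> w) f p \<in> star_ideal R'"
      using mult_left.IH[of "\<lambda>g. h (deg v + g) * c (deg v) g"]
      by (intro star_ideal.mult_left) simp
    then show ?case
      using add by (simp add: distrib_right weighted_map_add single star_ideal.add)
  qed
next
  case (mult_right p a)
  have single: "weighted_map (\<lambda>w. h (deg w) * \<psi> w) f (q * Poly_Mapping.single v x) =
      weighted_map (\<lambda>w. h (deg w + deg v) * c (deg w) (deg v) * \<psi> w) f q *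
      Poly_Mapping.single (f v) (x * \<psi> v)" for v x q
    by (induction q rule: poly_mapping_single_induct)
       (simp_all add: weighted_map_add distrib_right mult_single f_add weight_add deg_add algebra_simps)
  show ?case
  proof (induction a rule: poly_mapping_single_induct)
    case zero
    show ?case by (simp add: star_ideal.zero)
  next
    case (add v x a)
    have "weighted_map (\<lambda>w. h (deg w + deg v) * c (deg w) (deg v) * \<psi> w) f p *
        Poly_Mapping.single (f v) (x * \<psi> v) \<in> star_ideal R'"
      using mult_right.IH[of "\<lambda>g. h (g + deg v) * c g (deg v)"]
      by (intro star_ideal.mult_right) simp
    then show ?case
      using add by (simp add: distrib_left weighted_map_add single star_ideal.add)
  qed
next
  case (star p)
  have "weighted_map (\<lambda>w. h (deg w) * \<psi> w) f (free_star q) =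
      free_star (weighted_map (\<lambda>w. cnj (h (- deg w) * s (deg w)) * \<psi> w) f q)" for q
    by (induction q rule: poly_mapping_single_induct)
       (simp_all add: free_star_add weighted_map_add f_star deg_star weight_star algebra_simps)
  moreover have "free_star (weighted_map (\<lambda>w. cnj (h (- deg w) * s (deg w)) * \<psi> w) f p)
      \<in> star_ideal R'"
    using star.IH[of "\<lambda>g. cnj (h (- g) * s g)"] by (intro star_ideal.star) simp
  ultimately show ?case by simp
qed


section \<open>Bicharacters and ordered phases\<close>

lemma unitary_bicharacterD:
  assumes "unitary_bicharacter \<sigma>"
  shows "\<sigma> (x + y) z = \<sigma> x z * \<sigma> y z" "\<sigma> x (y + z) = \<sigma> x y * \<sigma> x z"
    "\<sigma> x y * cnj (\<sigma> x y) = 1" "cnj (\<sigma> x y) * \<sigma> x y = 1"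
    "\<sigma> 0 y = 1" "\<sigma> x 0 = 1" "\<sigma> (- x) y = cnj (\<sigma> x y)" "\<sigma> x (- y) = cnj (\<sigma> x y)"
proof -
  have norm: "norm (\<sigma> x y) = 1" for x y using assms by (simp add: unitary_bicharacter_def)
  then have nz: "\<sigma> x y \<noteq> 0" for x y by (metis norm_zero zero_neq_one)
  show add: "\<sigma> (x + y) z = \<sigma> x z * \<sigma> y z" "\<sigma> x (y + z) = \<sigma> x y * \<sigma> x z" for x y z
    using assms by (auto simp: unitary_bicharacter_def)
  show one: "\<sigma> x y * cnj (\<sigma> x y) = 1" "cnj (\<sigma> x y) * \<sigma> x y = 1" for x y
    using norm[of x y] by (simp_all add: complex_norm_square[symmetric] mult.commute)
  show z: "\<sigma> 0 y = 1" "\<sigma> x 0 = 1" for x y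
    using add(1)[of 0 0 y] add(2)[of x 0 0] nz by auto
  show "\<sigma> (- x) y = cnj (\<sigma> x y)"
    using add(1)[of x "- x" y] z(1)[of y] one(1)[of x y] nz[of x y]
    by (metis add.right_inverse mult_left_cancel)
  show "\<sigma> x (- y) = cnj (\<sigma> x y)"
    using add(2)[of x y "- y"] z(2)[of x] one(1)[of x y] nz[of x y]
    by (metis add.right_inverse mult_left_cancel)
qed

text \<open>The quotient of two bicharacters is what relates the corresponding twisted products.\<close>

lemma unitary_bicharacter_mult_cnj:
  assumes "unitary_bicharacter \<sigma>" "unitary_bicharacter \<sigma>'"
  shows "unitary_bicharacter (\<lambda>x y. \<sigma> x y * cnj (\<sigma>' x y))"
  using assms by (auto simp: unitary_bicharacter_def norm_mult)

text \<open>In the algebra twisted by \<open>c\<close>, the product of homogeneous elements of degrees \<open>x\<^sub>1, \<dots>, x\<^sub>n\<close> is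
  this phase times their product in the original algebra.\<close>

fun ordered_phase :: "('g::ab_group_add \<Rightarrow> 'g \<Rightarrow> complex) \<Rightarrow> 'g list \<Rightarrow> complex" where
  "ordered_phase c [] = 1"
| "ordered_phase c (x # xs) = c x (sum_list xs) * ordered_phase c xs"

lemma ordered_phase_append:
  assumes "unitary_bicharacter c"
  shows "ordered_phase c (xs @ ys) =
    c (sum_list xs) (sum_list ys) * ordered_phase c xs * ordered_phase c ys"
  by (induction xs) (simp_all add: unitary_bicharacterD[OF assms] algebra_simps)

lemma sum_list_map_uminus: "sum_list (map uminus xs) = - sum_list (xs :: 'g::ab_group_add list)"
  by (induction xs) simp_all

text \<open>The involution reverses products and inverts degrees. It is compatible with the twisted product
  only after each homogeneous element of degree \<open>x\<close> receives the additional phase \<open>c x x\<close>; this is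
  the identity behind that correction.\<close>

lemma ordered_phase_rev:
  assumes "unitary_bicharacter c"
  shows "ordered_phase c (rev (map uminus xs)) =
    c (sum_list xs) (sum_list xs) * (\<Prod>x\<leftarrow>xs. cnj (c x x)) * cnj (ordered_phase c xs)"
proof (induction xs)
  case (Cons x xs)
  let ?s = "sum_list xs"
  note b = unitary_bicharacterD[OF assms]
  have *: "c x ?s * cnj (c x ?s) = 1" "c x x * cnj (c x x) = 1" by (rule b)+
  have "ordered_phase c (rev (map uminus (x # xs))) =
      c ?s x * (c ?s ?s * (\<Prod>x\<leftarrow>xs. cnj (c x x)) * cnj (ordered_phase c xs))"
    using Cons by (simp add: ordered_phase_append[OF assms] sum_list_map_uminus sum_list_rev b)
  also have "\<dots> = (c x x * cnj (c x x)) * (c x ?s * cnj (c x ?s)) *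
      (c ?s x * (c ?s ?s * (\<Prod>x\<leftarrow>xs. cnj (c x x)) * cnj (ordered_phase c xs)))"
    by (simp only: * mult_1)
  also have "\<dots> = c (sum_list (x # xs)) (sum_list (x # xs)) * (\<Prod>x\<leftarrow>x # xs. cnj (c x x)) *
      cnj (ordered_phase c (x # xs))"
    by (simp add: b mult_ac)
  finally show ?case .
qed (simp add: unitary_bicharacterD[OF assms])

lemma ordered_phase_unit:
  assumes "unitary_bicharacter c"
  shows "ordered_phase c xs * cnj (ordered_phase c xs) = 1"
proof (induction xs)
  case (Cons x xs)
  have "ordered_phase c (x # xs) * cnj (ordered_phase c (x # xs)) =
      (c x (sum_list xs) * cnj (c x (sum_list xs))) *
      (ordered_phase c xs * cnj (ordered_phase c xs))" by (simp add: mult_ac)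
  then show ?case using Cons unitary_bicharacterD(3)[OF assms] by simp
qed simp

lemma ordered_phase_cnj: "ordered_phase (\<lambda>x y. cnj (c x y)) xs = cnj (ordered_phase c xs)"
  by (induction xs) simp_all

text \<open>With respect to \<open>e\<close>, the algebra is a twisted group algebra and \<open>A\<close> is diagonal. The unitaries \<open>t\<^sub>\<mu>\<close>
  of a twisted dual have norm \<open>sqrt N\<close> in \<open>l\<^sup>2\<close>, where \<open>N\<close> is the order of the group, so \<open>e i\<close> is
  \<open>t\<^bsub>d i\<^esub> / sqrt N\<close>. The conditions are put on the matrices of the structure maps because these are
  all that the quantum automorphism group and its intertwiners depend on. The labels \<open>'i\<close> are kept
  apart from the group since \<open>'i\<close> also names the coordinates of \<open>C(X)\<close>.\<close>


section \<open>Quantum graphs with a group-graded frame\<close>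

definition twisted_frame ::
    "'i::finite qset \<Rightarrow> (complex ^ 'i \<Rightarrow> complex ^ 'i) \<Rightarrow> ('i \<Rightarrow> complex ^ 'i) \<Rightarrow>
     ('i \<Rightarrow> 'g::ab_group_add) \<Rightarrow> ('g \<Rightarrow> 'g \<Rightarrow> complex) \<Rightarrow> ('g \<Rightarrow> complex) \<Rightarrow> bool" where
  "twisted_frame X A e d \<sigma> ev \<longleftrightarrow>
     orthonormal_basis X e \<and> bij d \<and> unitary_bicharacter \<sigma> \<and>
     (\<forall>k i j. mult_matrix X e [k] [i, j] =
        (if d k = d i + d j then cnj (\<sigma> (d i) (d j)) / sqrt (real CARD('g)) else 0)) \<and>
     (\<forall>i. unit_matrix X e [i] [] = (if d i = 0 then sqrt (real CARD('g)) else 0)) \<and>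
     (\<forall>j i. star_matrix X e j i = (if d j = - d i then \<sigma> (d i) (- d i) else 0)) \<and>
     (\<forall>i j. op_matrix X e A [i] [j] = (if i = j then ev (d i) else 0))"


section \<open>Degrees and phases of words\<close>

fun letter_degree :: "('i \<Rightarrow> 'g::ab_group_add) \<Rightarrow> 'i letter \<Rightarrow> 'g \<times> 'g" where
  "letter_degree d (Gen i j) = (d i, d j)"
| "letter_degree d (GenStar i j) = (- d i, - d j)"

fun word_degree :: "('i \<Rightarrow> 'g::ab_group_add) \<Rightarrow> 'i letter word \<Rightarrow> 'g \<times> 'g" where
  "word_degree d (Word w) = sum_list (map (letter_degree d) w)"

lemma word_degree_add: "word_degree d (v + w) = word_degree d v + word_degree d w"
  by (cases v; cases w) simp

lemma letter_degree_star: "letter_degree d (letter_star l) = - letter_degree d l"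
  by (cases l) simp_all

lemma word_degree_star: "word_degree d (word_star w) = - word_degree d w"
proof (cases w)
  case (Word w')
  have "map (letter_degree d \<circ> letter_star) w' = map uminus (map (letter_degree d) w')"
    by (simp add: letter_degree_star)
  then show ?thesis
    using Word by (simp add: rev_map[symmetric] sum_list_rev sum_list_map_uminus del: map_map)
      (metis map_map sum_list_map_uminus)
qed

lemma map_word_add: "map_word f (v + w) = map_word f v + map_word f w"
  by (cases v; cases w) simp

lemma map_letter_star: "map_letter f (letter_star l) = letter_star (map_letter f l)"
  by (cases l) simp_all

lemma map_word_star:
  "map_word (map_letter f) (word_star w) = word_star (map_word (map_letter f) w)"
  by (cases w) (simp add: rev_map map_letter_star)

text \<open>The generator \<open>u\<^sup>i\<^sub>j\<close> has a row degree and a column degree. Twisting the graph on which the quantum group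
  coacts twists the product by \<open>\<rho>\<close> in the rows and by the inverse of \<open>\<rho>\<close> in the columns.\<close>

definition bigraded :: "('g \<Rightarrow> 'g \<Rightarrow> complex) \<Rightarrow> 'g \<times> 'g \<Rightarrow> 'g \<times> 'g \<Rightarrow> complex" where
  "bigraded \<rho> x y = \<rho> (fst x) (fst y) * cnj (\<rho> (snd x) (snd y))"

lemma unitary_bicharacter_bigraded:
  "unitary_bicharacter \<rho> \<Longrightarrow> unitary_bicharacter (bigraded \<rho>)"
  unfolding unitary_bicharacter_def bigraded_def by (simp add: norm_mult)

text \<open>The phase of \<open>(u\<^sup>i\<^sub>j)\<^sup>*\<close> is the correction that the involution needs in the twisted algebra.\<close>

fun letter_phase :: "('g::ab_group_add \<Rightarrow> 'g \<Rightarrow> complex) \<Rightarrow> ('i \<Rightarrow> 'g) \<Rightarrow> 'i letter \<Rightarrow> complex" where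
  "letter_phase \<rho> d (Gen i j) = 1"
| "letter_phase \<rho> d (GenStar i j) = bigraded \<rho> (d i, d j) (d i, d j)"

fun word_phase ::
    "('g::ab_group_add \<Rightarrow> 'g \<Rightarrow> complex) \<Rightarrow> ('i \<Rightarrow> 'g) \<Rightarrow> 'i letter word \<Rightarrow> complex" where
  "word_phase \<rho> d (Word w) =
     ordered_phase (bigraded \<rho>) (map (letter_degree d) w) * (\<Prod>l\<leftarrow>w. letter_phase \<rho> d l)"

lemma word_phase_add:
  assumes "unitary_bicharacter \<rho>"
  shows "word_phase \<rho> d (v + w) =
    bigraded \<rho> (word_degree d v) (word_degree d w) * word_phase \<rho> d v * word_phase \<rho> d w"
  by (cases v; cases w)
     (simp add: ordered_phase_append[OF unitary_bicharacter_bigraded[OF assms]] mult_ac)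

lemma letter_phase_star:
  assumes "unitary_bicharacter \<rho>"
  shows "letter_phase \<rho> d (letter_star l) =
    bigraded \<rho> (letter_degree d l) (letter_degree d l) * cnj (letter_phase \<rho> d l)"
proof (cases l)
  case (GenStar i j)
  have "\<rho> x x * (\<rho> y y * (cnj (\<rho> x x) * cnj (\<rho> y y))) = 1" for x y
  proof -
    have "\<rho> x x * (\<rho> y y * (cnj (\<rho> x x) * cnj (\<rho> y y))) =
      (\<rho> x x * cnj (\<rho> x x)) * (\<rho> y y * cnj (\<rho> y y))" by (simp only: mult_ac)
    then show ?thesis by (simp add: unitary_bicharacterD[OF assms])
  qed
  with GenStar show ?thesis
    by (simp add: bigraded_def unitary_bicharacterD[OF assms] mult_ac)
qed simp

lemma word_phase_star:
  assumes "unitary_bicharacter \<rho>"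
  shows "word_phase \<rho> d (word_star w) =
    bigraded \<rho> (word_degree d w) (word_degree d w) * cnj (word_phase \<rho> d w)"
proof (cases w)
  case (Word ls)
  let ?c = "bigraded \<rho>"
  note b = unitary_bicharacter_bigraded[OF assms]
  have degs: "map (letter_degree d) (rev (map letter_star ls)) =
      rev (map uminus (map (letter_degree d) ls))"
    by (simp add: rev_map[symmetric] letter_degree_star)
  have phases: "(\<Prod>l\<leftarrow>ls. cnj (?c (letter_degree d l) (letter_degree d l))) *
      (\<Prod>l\<leftarrow>rev (map letter_star ls). letter_phase \<rho> d l) =
      cnj (\<Prod>l\<leftarrow>ls. letter_phase \<rho> d l)"
  proof (induction ls)
    case (Cons l ls)
    have one: "cnj (?c x x) * ?c x x = 1" for x by (rule unitary_bicharacterD(4)[OF b])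
    have "(\<Prod>l\<leftarrow>l # ls. cnj (?c (letter_degree d l) (letter_degree d l))) *
        (\<Prod>l\<leftarrow>rev (map letter_star (l # ls)). letter_phase \<rho> d l) =
      (cnj (?c (letter_degree d l) (letter_degree d l)) *
        ?c (letter_degree d l) (letter_degree d l)) * cnj (letter_phase \<rho> d l) *
      ((\<Prod>l\<leftarrow>ls. cnj (?c (letter_degree d l) (letter_degree d l))) *
        (\<Prod>l\<leftarrow>rev (map letter_star ls). letter_phase \<rho> d l))"
      by (simp add: letter_phase_star[OF assms] mult_ac)
    then show ?case using Cons one by simp
  qed simp
  show ?thesis
    using phases Word
    by (simp add: degs ordered_phase_rev[OF b] comp_def mult_ac del: map_map rev_map)
       (simp add: comp_def mult_ac)
qed

text \<open>Entries of the tensor powers of \<open>u\<close> are homogeneous, with the total labels of their row and of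
  their column as degrees.\<close>

lemma word_degree_gens:
  "length a = length b \<Longrightarrow>
   word_degree d (Word (map2 Gen a b)) = (sum_list (map d a), sum_list (map d b))"
  unfolding word_degree.simps
  by (induction a b rule: list_induct2) (simp_all add: zero_prod_def)

text \<open>The phase of an entry of a tensor power of \<open>u\<close> splits into a row phase and a column phase, so that
  on intertwiners the twist is a conjugation by a diagonal unitary matrix.\<close>

lemma word_phase_gens:
  assumes "unitary_bicharacter \<rho>" and "length a = length b"
  shows "word_phase \<rho> d (Word (map2 Gen a b)) =
    ordered_phase \<rho> (map d a) * cnj (ordered_phase \<rho> (map d b))"
  using assms(2)
proof (induction a b rule: list_induct2)
  case (Cons x xs y ys)
  then show ?case using word_degree_gens[of xs ys d]
    by (simp add: bigraded_def mult_ac)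
qed simp


section \<open>Twisting the relations of the quantum automorphism group\<close>

lemma single_word_mult:
  "Poly_Mapping.single (Word v) x * Poly_Mapping.single (Word w) y =
   Poly_Mapping.single (Word (v @ w)) (x * y :: complex)"
  by (simp add: mult_single)

lemmas monomial_simps = gen_def gen_star_def scalar_def zero_word_def single_word_mult

lemma scalar_times_single: "scalar z * Poly_Mapping.single w y = Poly_Mapping.single w (z * y)"
  by (simp add: scalar_def mult_single)

lemma sum_UNIV_bij: "bij \<beta> \<Longrightarrow> (\<Sum>k\<in>UNIV. g (\<beta> k)) = (\<Sum>k\<in>UNIV. g k)"
  by (rule sum.reindex_bij_betw)

text \<open>All monomials of one relation have the same degree, and their phases differ exactly by the factors
  by which the structure constants of the two frames differ. So each relation of the first
  quantum automorphism group becomes a multiple of the corresponding relation of the second.\<close>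

lemma twist_relations:
  fixes d :: "'i::finite \<Rightarrow> 'g::ab_group_add" and d' :: "'j::finite \<Rightarrow> 'g"
  assumes X: "twisted_frame X A e d \<sigma> ev" and Y: "twisted_frame Y B f d' \<sigma>' ev"
    and \<beta>: "bij \<beta>" and d': "\<And>i. d' (\<beta> i) = d i"
    and \<rho>: "\<rho> = (\<lambda>x y. \<sigma> x y * cnj (\<sigma>' x y))"
    and p: "p \<in> aut_relations X A e"
  shows "weighted_map (\<lambda>w. h (word_degree d w) * word_phase \<rho> d w) (map_word (map_letter \<beta>)) p
    \<in> star_ideal (aut_relations Y B f)"
proof -
  let ?W = "weighted_map (\<lambda>w. h (word_degree d w) * word_phase \<rho> d w) (map_word (map_letter \<beta>))"
  note [simp del] = mult_matrix.simps op_matrix.simps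
  have s: "unitary_bicharacter \<sigma>" and s': "unitary_bicharacter \<sigma>'"
    using X Y by (auto simp: twisted_frame_def)
  have "unitary_bicharacter \<rho>"
    unfolding \<rho> by (rule unitary_bicharacter_mult_cnj[OF s s'])
  note b = unitary_bicharacterD[OF this] and bs = unitary_bicharacterD[OF s]
    and bs' = unitary_bicharacterD[OF s']
  have bz: "bigraded \<rho> x 0 = 1" for x by (simp add: bigraded_def b)
  have inj: "\<beta> i = \<beta> j \<longleftrightarrow> i = j" for i j using \<beta> by (metis bij_def inj_eq)
  have mX: "mult_matrix X e [k] [i, j] =
        (if d k = d i + d j then cnj (\<sigma> (d i) (d j)) / sqrt (real CARD('g)) else 0)"
    and mY: "mult_matrix Y f [\<beta> k] [\<beta> i, \<beta> j] =
        (if d k = d i + d j then cnj (\<sigma>' (d i) (d j)) / sqrt (real CARD('g)) else 0)"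
    and stX: "star_matrix X e j i = (if d j = - d i then \<sigma> (d i) (- d i) else 0)"
    and stY: "star_matrix Y f (\<beta> j) (\<beta> i) = (if d j = - d i then \<sigma>' (d i) (- d i) else 0)"
    and opX: "op_matrix X e A [i] [j] = (if i = j then ev (d i) else 0)"
    and opY: "op_matrix Y f B [\<beta> i] [\<beta> j] = (if i = j then ev (d i) else 0)" for i j k
    using X Y by (auto simp: twisted_frame_def d' inj)
  have split: "\<sigma> x y = \<rho> x y * \<sigma>' x y" for x y
    using bs'(4)[of x y] by (simp add: \<rho> mult.assoc)
  have conclude: "?W q \<in> star_ideal (aut_relations Y B f)"
    if "?W q = scalar z * q'" "q' \<in> aut_relations Y B f" for q q' z
    using that by (metis star_ideal.base star_ideal_scale)
  from p consider
      (1) i j where "p = (\<Sum>k\<in>UNIV. gen i k * gen_star j k) - scalar (if i = j then 1 else 0)"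
    | (2) i j where "p = (\<Sum>k\<in>UNIV. gen_star k i * gen k j) - scalar (if i = j then 1 else 0)"
    | (3) i j where "p = (\<Sum>k\<in>UNIV. gen i k * scalar (star_matrix X e k j))
        - (\<Sum>k\<in>UNIV. scalar (star_matrix X e i k) * gen_star k j)"
    | (4) k i j where "p =
        (\<Sum>a\<in>UNIV. \<Sum>b\<in>UNIV. scalar (mult_matrix X e [k] [a, b]) * gen a i * gen b j)
        - (\<Sum>c\<in>UNIV. gen k c * scalar (mult_matrix X e [c] [i, j]))"
    | (5) i j where "p = (\<Sum>k\<in>UNIV. scalar (op_matrix X e A [i] [k]) * gen k j)
        - (\<Sum>k\<in>UNIV. gen i k * scalar (op_matrix X e A [k] [j]))"
    unfolding aut_relations_def by blast
  then show ?thesis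
  proof cases
    case 1
    let ?i = "\<beta> i" and ?j = "\<beta> j"
    let ?q = "(\<Sum>k\<in>UNIV. gen ?i k * gen_star ?j k) - scalar (if ?i = ?j then 1 else 0)"
    \<comment> \<open>The summation index drops out of the phase because \<open>\<rho> (d k) (d k)\<close> occurs with its conjugate; for
      \<open>i = j\<close> the phase is \<open>1\<close>, as the scalar term demands.\<close>
    let ?z = "h (d i - d j, 0) * (\<rho> (d j) (d j) * cnj (\<rho> (d i) (d j)))"
    have ph: "word_phase \<rho> d (Word [Gen i k, GenStar j k]) =
        \<rho> (d j) (d j) * cnj (\<rho> (d i) (d j)) * (\<rho> (d k) (d k) * cnj (\<rho> (d k) (d k)))" for k
      by (simp add: bigraded_def b)
    have "?W p = (\<Sum>k\<in>UNIV. Poly_Mapping.single (Word [Gen ?i (\<beta> k), GenStar ?j (\<beta> k)]) ?z)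
        - scalar (if ?i = ?j then ?z else 0)"
      unfolding 1
      by (simp add: monomial_simps weighted_map_diff weighted_map_sum ph inj b
            del: word_phase.simps) (simp add: zero_prod_def)
    also have "\<dots> = (\<Sum>k\<in>UNIV. Poly_Mapping.single (Word [Gen ?i k, GenStar ?j k]) ?z)
        - scalar (if ?i = ?j then ?z else 0)"
      using sum_UNIV_bij[OF \<beta>, of "\<lambda>k. Poly_Mapping.single (Word [Gen ?i k, GenStar ?j k]) ?z"]
      by simp
    also have "\<dots> = scalar ?z * ?q"
      by (simp add: right_diff_distrib sum_distrib_left monomial_simps)
    finally have "?W p = scalar ?z * ?q" .
    then show ?thesis by (rule conclude) (auto simp: aut_relations_def)
  next
    case 2
    let ?i = "\<beta> i" and ?j = "\<beta> j"
    let ?q = "(\<Sum>k\<in>UNIV. gen_star k ?i * gen k ?j) - scalar (if ?i = ?j then 1 else 0)"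
    let ?z = "h (0, d j - d i) * (\<rho> (d i) (d j) * cnj (\<rho> (d i) (d i)))"
    have ph: "word_phase \<rho> d (Word [GenStar k i, Gen k j]) =
        \<rho> (d i) (d j) * cnj (\<rho> (d i) (d i)) * (\<rho> (d k) (d k) * cnj (\<rho> (d k) (d k)))" for k
      by (simp add: bigraded_def b)
    have "?W p = (\<Sum>k\<in>UNIV. Poly_Mapping.single (Word [GenStar (\<beta> k) ?i, Gen (\<beta> k) ?j]) ?z)
        - scalar (if ?i = ?j then ?z else 0)"
      unfolding 2
      by (simp add: monomial_simps weighted_map_diff weighted_map_sum ph inj b
            del: word_phase.simps) (simp add: zero_prod_def)
    also have "\<dots> = (\<Sum>k\<in>UNIV. Poly_Mapping.single (Word [GenStar k ?i, Gen k ?j]) ?z)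
        - scalar (if ?i = ?j then ?z else 0)"
      using sum_UNIV_bij[OF \<beta>, of "\<lambda>k. Poly_Mapping.single (Word [GenStar k ?i, Gen k ?j]) ?z"]
      by simp
    also have "\<dots> = scalar ?z * ?q"
      by (simp add: right_diff_distrib sum_distrib_left monomial_simps)
    finally have "?W p = scalar ?z * ?q" .
    then show ?thesis by (rule conclude) (auto simp: aut_relations_def)
  next
    case 3
    let ?i = "\<beta> i" and ?j = "\<beta> j"
    let ?q = "(\<Sum>k\<in>UNIV. gen ?i k * scalar (star_matrix Y f k ?j))
        - (\<Sum>k\<in>UNIV. scalar (star_matrix Y f ?i k) * gen_star k ?j)"
    let ?z = "h (d i, - d j) * cnj (\<rho> (d j) (d j))"
    have l: "star_matrix X e k j * (h (d i, d k) * 1) = ?z * star_matrix Y f (\<beta> k) ?j" for k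
      by (simp add: stX stY split bs bs' b)
    have r: "star_matrix X e i k *
          (h (- d k, - d j) * word_phase \<rho> d (Word [GenStar k j])) =
        ?z * star_matrix Y f ?i (\<beta> k)" for k
    proof (cases "d i = - d k")
      case True
      then show ?thesis
        using b(4)[of "d k" "d k"] by (simp add: stX stY split bs bs' b bigraded_def)
    qed (simp add: stX stY)
    have "?W p = (\<Sum>k\<in>UNIV. Poly_Mapping.single (Word [Gen ?i (\<beta> k)])
            (?z * star_matrix Y f (\<beta> k) ?j))
        - (\<Sum>k\<in>UNIV. Poly_Mapping.single (Word [GenStar (\<beta> k) ?j])
            (?z * star_matrix Y f ?i (\<beta> k)))"
      unfolding 3 l[symmetric] r[symmetric]
      by (simp add: monomial_simps weighted_map_diff weighted_map_sum bz)
    also have "\<dots> = (\<Sum>k\<in>UNIV. Poly_Mapping.single (Word [Gen ?i k])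
            (?z * star_matrix Y f k ?j))
        - (\<Sum>k\<in>UNIV. Poly_Mapping.single (Word [GenStar k ?j]) (?z * star_matrix Y f ?i k))"
      using sum_UNIV_bij[OF \<beta>, of "\<lambda>k. Poly_Mapping.single (Word [Gen ?i k])
            (?z * star_matrix Y f k ?j)"]
        sum_UNIV_bij[OF \<beta>, of "\<lambda>k. Poly_Mapping.single (Word [GenStar k ?j])
            (?z * star_matrix Y f ?i k)"]
      by simp
    also have "\<dots> = scalar ?z * ?q"
      by (simp add: right_diff_distrib sum_distrib_left monomial_simps)
    finally have "?W p = scalar ?z * ?q" .
    then show ?thesis by (rule conclude) (auto simp: aut_relations_def)
  next
    case 4
    let ?i = "\<beta> i" and ?j = "\<beta> j" and ?k = "\<beta> k"
    let ?q = "(\<Sum>a\<in>UNIV. \<Sum>b\<in>UNIV. scalar (mult_matrix Y f [?k] [a, b]) * gen a ?i * gen b ?j)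
        - (\<Sum>c\<in>UNIV. gen ?k c * scalar (mult_matrix Y f [c] [?i, ?j]))"
    let ?z = "h (d k, d i + d j) * cnj (\<rho> (d i) (d j))"
    have l: "mult_matrix X e [k] [a, b] *
          (h (d a + d b, d i + d j) * word_phase \<rho> d (Word [Gen a i, Gen b j])) =
        ?z * mult_matrix Y f [?k] [\<beta> a, \<beta> b]" for a b
      using b(3)[of "d a" "d b"] by (simp add: mX mY split bigraded_def b)
    have r: "mult_matrix X e [c] [i, j] * (h (d k, d c) * 1) =
        ?z * mult_matrix Y f [\<beta> c] [?i, ?j]" for c
      by (simp add: mX mY split)
    have "?W p = (\<Sum>a\<in>UNIV. \<Sum>b\<in>UNIV. Poly_Mapping.single (Word [Gen (\<beta> a) ?i, Gen (\<beta> b) ?j])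
            (?z * mult_matrix Y f [?k] [\<beta> a, \<beta> b]))
        - (\<Sum>c\<in>UNIV. Poly_Mapping.single (Word [Gen ?k (\<beta> c)])
            (?z * mult_matrix Y f [\<beta> c] [?i, ?j]))"
      unfolding 4 l[symmetric] r[symmetric]
      by (simp add: monomial_simps weighted_map_diff weighted_map_sum bz)
    also have "\<dots> = (\<Sum>a\<in>UNIV. \<Sum>b\<in>UNIV. Poly_Mapping.single (Word [Gen a ?i, Gen b ?j])
            (?z * mult_matrix Y f [?k] [a, b]))
        - (\<Sum>c\<in>UNIV. Poly_Mapping.single (Word [Gen ?k c]) (?z * mult_matrix Y f [c] [?i, ?j]))"
      using sum_UNIV_bij[OF \<beta>, of "\<lambda>a. \<Sum>b\<in>UNIV. Poly_Mapping.single
            (Word [Gen a ?i, Gen (\<beta> b) ?j]) (?z * mult_matrix Y f [?k] [a, \<beta> b])"]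
        sum_UNIV_bij[OF \<beta>, of "\<lambda>b. Poly_Mapping.single (Word [Gen a ?i, Gen b ?j])
            (?z * mult_matrix Y f [?k] [a, b])" for a]
        sum_UNIV_bij[OF \<beta>, of "\<lambda>c. Poly_Mapping.single (Word [Gen ?k c])
            (?z * mult_matrix Y f [c] [?i, ?j])"]
      by simp
    also have "\<dots> = scalar ?z * ?q"
      by (simp add: right_diff_distrib sum_distrib_left monomial_simps)
    finally have "?W p = scalar ?z * ?q" .
    then show ?thesis by (rule conclude) (auto simp: aut_relations_def)
  next
    case 5
    let ?i = "\<beta> i" and ?j = "\<beta> j"
    let ?q = "(\<Sum>k\<in>UNIV. scalar (op_matrix Y f B [?i] [k]) * gen k ?j)
        - (\<Sum>k\<in>UNIV. gen ?i k * scalar (op_matrix Y f B [k] [?j]))"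
    let ?z = "h (d i, d j)"
    have l: "op_matrix X e A [i] [k] * (h (d k, d j) * 1) = ?z * op_matrix Y f B [?i] [\<beta> k]" for k
      by (simp add: opX opY)
    have r: "op_matrix X e A [k] [j] * (h (d i, d k) * 1) = ?z * op_matrix Y f B [\<beta> k] [?j]" for k
      by (simp add: opX opY)
    have "?W p = (\<Sum>k\<in>UNIV. Poly_Mapping.single (Word [Gen (\<beta> k) ?j])
            (?z * op_matrix Y f B [?i] [\<beta> k]))
        - (\<Sum>k\<in>UNIV. Poly_Mapping.single (Word [Gen ?i (\<beta> k)])
            (?z * op_matrix Y f B [\<beta> k] [?j]))"
      unfolding 5 l[symmetric] r[symmetric]
      by (simp add: monomial_simps weighted_map_diff weighted_map_sum bz)
    also have "\<dots> = (\<Sum>k\<in>UNIV. Poly_Mapping.single (Word [Gen k ?j])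
            (?z * op_matrix Y f B [?i] [k]))
        - (\<Sum>k\<in>UNIV. Poly_Mapping.single (Word [Gen ?i k]) (?z * op_matrix Y f B [k] [?j]))"
      using sum_UNIV_bij[OF \<beta>, of "\<lambda>k. Poly_Mapping.single (Word [Gen k ?j])
            (?z * op_matrix Y f B [?i] [k])"]
        sum_UNIV_bij[OF \<beta>, of "\<lambda>k. Poly_Mapping.single (Word [Gen ?i k])
            (?z * op_matrix Y f B [k] [?j])"]
      by simp
    also have "\<dots> = scalar ?z * ?q"
      by (simp add: right_diff_distrib sum_distrib_left monomial_simps)
    finally have "?W p = scalar ?z * ?q" .
    then show ?thesis by (rule conclude) (auto simp: aut_relations_def)
  qed
qed


section \<open>Twisting and grading of intertwiners\<close>

lemma tensor_power_entry_eq: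
  "tensor_power_entry a b = Poly_Mapping.single (Word (map2 Gen a b)) 1"
proof -
  have "prod_list (map2 gen a b) = Poly_Mapping.single (Word (map2 Gen a b)) 1" for a b :: "'a list"
  proof (induction a arbitrary: b)
    case Nil
    show ?case by (simp add: zero_word_def[symmetric])
  next
    case (Cons x a)
    then show ?case
      by (cases b) (simp_all add: gen_def single_word_mult zero_word_def[symmetric])
  qed
  then show ?thesis by (simp add: tensor_power_entry_def)
qed

text \<open>The entry \<open>(a, b)\<close> of \<open>T u\<^sup>\<otimes>\<^sup>k - u\<^sup>\<otimes>\<^sup>l T\<close>.\<close>

definition intertwining_defect :: "nat \<Rightarrow> nat \<Rightarrow> 'i::finite tmatrix \<Rightarrow> 'i list \<Rightarrow> 'i list \<Rightarrow> 'i free_alg" where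
  "intertwining_defect k l T a b =
     (\<Sum>c | length c = k. Poly_Mapping.single (Word (map2 Gen c b)) (T a c))
     - (\<Sum>c | length c = l. Poly_Mapping.single (Word (map2 Gen a c)) (T c b))"

lemma intertwiners_iff:
  "T \<in> intertwiners X A e k l \<longleftrightarrow>
     (\<forall>a b. T a b \<noteq> 0 \<longrightarrow> length a = l \<and> length b = k) \<and>
     (\<forall>a b. length a = l \<longrightarrow> length b = k \<longrightarrow>
        intertwining_defect k l T a b \<in> star_ideal (aut_relations X A e))"
  by (simp add: intertwiners_def aut_ideal_def intertwining_defect_def tensor_power_entry_eq
      scalar_def mult_single)

text \<open>Conjugation by the diagonal matrix of ordered phases, together with the relabelling \<open>\<gamma>\<close> of the basis.\<close>

definition twist_matrix ::
    "('g::ab_group_add \<Rightarrow> 'g \<Rightarrow> complex) \<Rightarrow> ('j \<Rightarrow> 'g) \<Rightarrow> ('j \<Rightarrow> 'i) \<Rightarrow> 'i tmatrix \<Rightarrow> 'j tmatrix" where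
  "twist_matrix \<rho> d \<gamma> T = (\<lambda>a b. cnj (ordered_phase \<rho> (map d a)) * T (map \<gamma> a) (map \<gamma> b) *
     ordered_phase \<rho> (map d b))"

lemma sum_lists_bij:
  assumes "bij \<gamma>"
  shows "(\<Sum>c | length c = n. g (map \<gamma> c)) = (\<Sum>c | length c = n. g c)"
proof -
  have "bij_betw (map \<gamma>) {c. length c = n} {c. length c = n}"
    using assms
    by (intro bij_betw_byWitness[where f' = "map (inv \<gamma>)"])
       (auto simp: bij_is_inj surj_iff[THEN iffD1, OF bij_is_surj])
  then show ?thesis by (rule sum.reindex_bij_betw)
qed

text \<open>The twist sends the equations that make \<open>T\<close> an intertwiner to equations between the twisted
  monomials. The phases of these monomials split into row and column parts and can be absorbed
  into \<open>T\<close>.\<close>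

lemma twist_intertwiner:
  fixes d :: "'i::finite \<Rightarrow> 'g::ab_group_add" and d' :: "'j::finite \<Rightarrow> 'g"
  assumes X: "twisted_frame X A e d \<sigma> ev" and Y: "twisted_frame Y B f d' \<sigma>' ev"
    and \<gamma>: "bij \<gamma>" and d': "\<And>j. d (\<gamma> j) = d' j"
    and \<rho>: "\<rho> = (\<lambda>x y. \<sigma> x y * cnj (\<sigma>' x y))"
    and T: "T \<in> intertwiners X A e k l"
  shows "twist_matrix \<rho> d' \<gamma> T \<in> intertwiners Y B f k l"
  unfolding intertwiners_iff
proof (intro conjI allI impI)
  fix a b assume "twist_matrix \<rho> d' \<gamma> T a b \<noteq> 0"
  then have "T (map \<gamma> a) (map \<gamma> b) \<noteq> 0" by (simp add: twist_matrix_def)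
  then have "length (map \<gamma> a) = l \<and> length (map \<gamma> b) = k" using T by (simp only: intertwiners_iff)
  then show "length a = l" "length b = k" by simp_all
next
  fix a b :: "'j list" assume len: "length a = l" "length b = k"
  have b\<rho>: "unitary_bicharacter \<rho>"
    unfolding \<rho> by (rule unitary_bicharacter_mult_cnj) (use X Y in \<open>auto simp: twisted_frame_def\<close>)
  let ?\<beta> = "inv \<gamma>"
  let ?\<omega> = "\<lambda>a. ordered_phase \<rho> (map d' a)"
  have \<beta>: "bij ?\<beta>" and d: "d' (?\<beta> i) = d i" for i
    using \<gamma> d'[of "?\<beta> i"] by (simp_all add: bij_imp_bij_inv bij_is_surj surj_f_inv_f)
  have \<beta>\<gamma>: "map ?\<beta> (map \<gamma> c) = c" for c using \<gamma> by (simp add: bij_is_inj)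
  have d\<gamma>: "map d (map \<gamma> c) = map d' c" for c using d' by simp
  let ?W = "weighted_map (\<lambda>w. 1 * word_phase \<rho> d w) (map_word (map_letter ?\<beta>))"
  have "intertwining_defect k l T (map \<gamma> a) (map \<gamma> b) \<in> star_ideal (aut_relations X A e)"
    using T len by (simp add: intertwiners_iff)
  then have in_ideal: "?W (intertwining_defect k l T (map \<gamma> a) (map \<gamma> b))
      \<in> star_ideal (aut_relations Y B f)"
    by (rule star_ideal_transfer[where deg = "word_degree d" and c = "bigraded \<rho>"
          and s = "\<lambda>g. bigraded \<rho> g g" and h = "\<lambda>_. 1" and R = "aut_relations X A e", rotated -1])
       (rule word_degree_add map_word_add word_phase_add[OF b\<rho>] word_degree_star map_word_star
          word_phase_star[OF b\<rho>] twist_relations[OF X Y \<beta> d \<rho>] | assumption)+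
  have ren: "map_word (map_letter ?\<beta>) (Word (map2 Gen (map \<gamma> c) (map \<gamma> c'))) = Word (map2 Gen c c')"
    for c c'
  proof -
    have "map (map_letter ?\<beta>) (map2 Gen (map \<gamma> c) (map \<gamma> c')) = map2 Gen c c'"
      using \<gamma> by (simp add: zip_map_map comp_def case_prod_beta bij_is_inj)
    then show ?thesis by simp
  qed
  have W: "?W (Poly_Mapping.single (Word (map2 Gen (map \<gamma> c) (map \<gamma> c'))) z) =
      Poly_Mapping.single (Word (map2 Gen c c')) (z * (?\<omega> c * cnj (?\<omega> c')))"
    if "length c = length c'" for c c' z
    using that unfolding weighted_map_single ren
    by (subst word_phase_gens[OF b\<rho>]) (simp_all only: length_map d\<gamma> mult_1)
  have "?W (intertwining_defect k l T (map \<gamma> a) (map \<gamma> b)) =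
      (\<Sum>c | length c = k. ?W (Poly_Mapping.single (Word (map2 Gen (map \<gamma> c) (map \<gamma> b)))
          (T (map \<gamma> a) (map \<gamma> c))))
      - (\<Sum>c | length c = l. ?W (Poly_Mapping.single (Word (map2 Gen (map \<gamma> a) (map \<gamma> c)))
          (T (map \<gamma> c) (map \<gamma> b))))"
    unfolding intertwining_defect_def weighted_map_diff weighted_map_sum
    by (intro arg_cong2[where f = minus] sum_lists_bij[OF \<gamma>, symmetric])
  also have "\<dots> = (\<Sum>c | length c = k. Poly_Mapping.single (Word (map2 Gen c b))
          (T (map \<gamma> a) (map \<gamma> c) * (?\<omega> c * cnj (?\<omega> b))))
      - (\<Sum>c | length c = l. Poly_Mapping.single (Word (map2 Gen a c))
          (T (map \<gamma> c) (map \<gamma> b) * (?\<omega> a * cnj (?\<omega> c))))"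
    using len by (intro arg_cong2[where f = minus] sum.cong refl W) auto
  finally have Weq: "?W (intertwining_defect k l T (map \<gamma> a) (map \<gamma> b)) = \<dots>" .
  have one: "?\<omega> c * cnj (?\<omega> c) = 1" "cnj (?\<omega> c) * ?\<omega> c = 1" for c
    using ordered_phase_unit[OF b\<rho>] by (simp_all add: mult.commute)
  have l: "cnj (?\<omega> a) * ?\<omega> b * (t * (?\<omega> c * cnj (?\<omega> b))) = cnj (?\<omega> a) * t * ?\<omega> c" for t c
  proof -
    have "cnj (?\<omega> a) * ?\<omega> b * (t * (?\<omega> c * cnj (?\<omega> b))) =
        cnj (?\<omega> a) * t * ?\<omega> c * (?\<omega> b * cnj (?\<omega> b))" by (simp only: mult_ac)
    then show ?thesis by (simp add: one)
  qed
  have r: "cnj (?\<omega> a) * ?\<omega> b * (t * (?\<omega> a * cnj (?\<omega> c))) = cnj (?\<omega> c) * t * ?\<omega> b" for t c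
  proof -
    have "cnj (?\<omega> a) * ?\<omega> b * (t * (?\<omega> a * cnj (?\<omega> c))) =
        cnj (?\<omega> c) * t * ?\<omega> b * (?\<omega> a * cnj (?\<omega> a))" by (simp only: mult_ac)
    then show ?thesis by (simp add: one)
  qed
  have "intertwining_defect k l (twist_matrix \<rho> d' \<gamma> T) a b =
      scalar (cnj (?\<omega> a) * ?\<omega> b) * ?W (intertwining_defect k l T (map \<gamma> a) (map \<gamma> b))"
    unfolding Weq right_diff_distrib sum_distrib_left scalar_times_single l r
    by (simp add: intertwining_defect_def twist_matrix_def)
  then show "intertwining_defect k l (twist_matrix \<rho> d' \<gamma> T) a b \<in> star_ideal (aut_relations Y B f)"
    using star_ideal_scale[OF in_ideal] by simp
qed

fun diagonal_letter :: "'i letter \<Rightarrow> bool" where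
  "diagonal_letter (Gen i j) \<longleftrightarrow> i = j"
| "diagonal_letter (GenStar i j) \<longleftrightarrow> i = j"

fun diagonal_word :: "'i letter word \<Rightarrow> bool" where
  "diagonal_word (Word w) \<longleftrightarrow> list_all diagonal_letter w"

lemma diagonal_word_add: "diagonal_word (v + w) \<longleftrightarrow> diagonal_word v \<and> diagonal_word w"
  by (cases v; cases w) simp

lemma diagonal_word_star: "diagonal_word (word_star w) \<longleftrightarrow> diagonal_word w"
proof -
  have "diagonal_letter (letter_star l) = diagonal_letter l" for l :: "'i letter" by (cases l) auto
  then show ?thesis by (cases w) (auto simp: list_all_iff)
qed

lemma diagonal_word_gens:
  "length a = length b \<Longrightarrow> diagonal_word (Word (map2 Gen a b)) \<longleftrightarrow> a = b"
  by (simp, induction a b rule: list_induct2) auto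

lemma sum_single: "(\<Sum>i\<in>I. Poly_Mapping.single w (c i)) = Poly_Mapping.single w (\<Sum>i\<in>I. c i)"
  by (induction I rule: infinite_finite_induct) (simp_all add: single_add)

text \<open>Sending \<open>u\<^sup>i\<^sub>j\<close> to \<open>\<delta>\<^sub>i\<^sub>j\<close> times the group element \<open>d i\<close> is a representation of the quantum
  automorphism group in the group algebra: it restricts the coaction to the dual group, acting on
  the graph through the grading. The function \<open>h\<close> is an arbitrary linear functional on the group algebra.\<close>

lemma relations_diagonal:
  fixes d :: "'i::finite \<Rightarrow> 'g::ab_group_add"
  assumes X: "twisted_frame X A e d \<sigma> ev" and p: "p \<in> aut_relations X A e"
  shows "weighted_map (\<lambda>w. h (fst (word_degree d w)) * of_bool (diagonal_word w)) (\<lambda>_. 0) p = 0"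
proof -
  note [simp del] = mult_matrix.simps op_matrix.simps
  have mX: "mult_matrix X e [k] [i, j] * h (d i + d j) = mult_matrix X e [k] [i, j] * h (d k)" for i j k
    using X by (auto simp: twisted_frame_def)
  have stX: "star_matrix X e j i * h (d j) = star_matrix X e j i * h (- d i)" for i j
    using X by (auto simp: twisted_frame_def)
  have opX: "op_matrix X e A [i] [j] * h (d j) - op_matrix X e A [i] [j] * h (d i) = 0" for i j
    using X by (auto simp: twisted_frame_def)
  have delta: "(\<Sum>k\<in>UNIV. z k * of_bool (k = i)) = z i" "(\<Sum>k\<in>UNIV. z k * of_bool (i = k)) = z i"
    for z :: "'i \<Rightarrow> complex" and i by (simp_all add: of_bool_def if_distrib cong: if_cong)
  show ?thesis
    using p unfolding aut_relations_def
    by (elim UnE CollectE exE conjE)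
      (simp_all add: monomial_simps weighted_map_diff weighted_map_sum sum_single
        of_bool_conj mult.assoc[symmetric] delta mX stX opX flip: single_diff)
qed

lemma star_ideal_empty: "p \<in> star_ideal {} \<Longrightarrow> p = 0"
  by (induction rule: star_ideal.induct) auto

text \<open>An intertwiner commutes with the action of the dual group, whose characters separate degrees. The
  proof evaluates the intertwining relation on diagonal words.\<close>

lemma intertwiner_graded:
  fixes d :: "'i::finite \<Rightarrow> 'g::ab_group_add"
  assumes X: "twisted_frame X A e d \<sigma> ev" and T: "T \<in> intertwiners X A e k l" and nz: "T a b \<noteq> 0"
  shows "sum_list (map d a) = sum_list (map d b)"
proof -
  have len: "length a = l" "length b = k" using T nz by (auto simp: intertwiners_iff)
  \<comment> \<open>The functional picks out the degree of \<open>a\<close>; on diagonal words the two terms of the defect carry the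
    degrees of \<open>b\<close> and of \<open>a\<close>.\<close>
  let ?h = "\<lambda>g. of_bool (g = sum_list (map d a))"
  let ?W = "weighted_map (\<lambda>w. ?h (fst (word_degree d w)) * of_bool (diagonal_word w))
    (\<lambda>_. 0 :: 'i letter word)"
  have star0: "word_star 0 = (0 :: 'i letter word)" by (simp add: zero_word_def)
  have "intertwining_defect k l T a b \<in> star_ideal (aut_relations X A e)"
    using T len by (simp add: intertwiners_iff)
  then have "?W (intertwining_defect k l T a b) \<in> star_ideal {}"
    by (rule star_ideal_transfer[where deg = "\<lambda>w. fst (word_degree d w)" and c = "\<lambda>_ _. 1"
          and s = "\<lambda>_. 1" and h = ?h and R = "aut_relations X A e", rotated -1])
       (simp_all add: word_degree_add diagonal_word_add of_bool_conj word_degree_star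
          diagonal_word_star relations_diagonal[OF X] star_ideal.zero star0)
  then have "?W (intertwining_defect k l T a b) = 0" by (rule star_ideal_empty)
  moreover have "?W (intertwining_defect k l T a b) =
      Poly_Mapping.single 0 (T a b * ?h (sum_list (map d b)) - T a b)"
  proof -
    have W: "?W (Poly_Mapping.single (Word (map2 Gen c c')) z) =
        Poly_Mapping.single 0 (if c = c' then z * ?h (sum_list (map d c)) else 0)"
      if "length c = length c'" for c c' z
      using that unfolding weighted_map_single
        diagonal_word_gens[OF that] word_degree_gens[OF that] by simp
    have "?W (intertwining_defect k l T a b) =
        (\<Sum>c | length c = k. Poly_Mapping.single 0
            (if c = b then T a c * ?h (sum_list (map d c)) else 0))
        - (\<Sum>c | length c = l. Poly_Mapping.single 0
            (if a = c then T c b * ?h (sum_list (map d a)) else 0))"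
      unfolding intertwining_defect_def weighted_map_diff weighted_map_sum
      using len by (intro arg_cong2[where f = minus] sum.cong refl W) auto
    also have "\<dots> = Poly_Mapping.single 0 (T a b * ?h (sum_list (map d b)) - T a b)"
      using len finite_lists_length_eq[of "UNIV :: 'i set"]
      by (simp add: sum_single single_diff)
    finally show ?thesis .
  qed
  ultimately have "T a b * ?h (sum_list (map d b)) - T a b = 0"
    by (metis lookup_single_eq lookup_zero)
  then show ?thesis using nz by (auto split: if_splits)
qed


section \<open>Graded frames determine the quantum isomorphism class\<close>

lemma op_matrix_shape:
  "op_matrix X e A a b \<noteq> 0 \<Longrightarrow> \<exists>i j. a = [i] \<and> b = [j]"
  by (cases "(X, e, A, a, b)" rule: op_matrix.cases) auto

lemma mult_matrix_shape:
  "mult_matrix X e a b \<noteq> 0 \<Longrightarrow> \<exists>k i j. a = [k] \<and> b = [i, j]"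
  by (cases "(X, e, a, b)" rule: mult_matrix.cases) auto

lemma unit_matrix_shape:
  "unit_matrix X e a b \<noteq> 0 \<Longrightarrow> \<exists>i. a = [i] \<and> b = []"
  by (cases "(X, e, a, b)" rule: unit_matrix.cases) auto

text \<open>Both sides vanish outside the matrix entries of the right shape, so only those are to be compared.\<close>

lemma twist_matrix_eqI:
  assumes "\<And>a b. (length a, length b) = (l, k) \<Longrightarrow> twist_matrix \<rho> d \<gamma> T a b = T' a b"
    and "\<And>a b. T a b \<noteq> 0 \<Longrightarrow> (length a, length b) = (l, k)"
    and "\<And>a b. T' a b \<noteq> 0 \<Longrightarrow> (length a, length b) = (l, k)"
  shows "twist_matrix \<rho> d \<gamma> T = T'"
proof (intro ext)
  fix a b
  show "twist_matrix \<rho> d \<gamma> T a b = T' a b"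
  proof (cases "(length a, length b) = (l, k)")
    case False
    then have "T (map \<gamma> a) (map \<gamma> b) = 0" "T' a b = 0"
      using assms(2)[of "map \<gamma> a" "map \<gamma> b"] assms(3)[of a b] by auto
    then show ?thesis by (simp add: twist_matrix_def)
  qed (rule assms(1))
qed

text \<open>The phase of a concatenation of two index lists is the product of their phases and of
  \<open>\<rho>\<close> of their degrees. In a tensor product of intertwiners, row and column degrees
  agree factor by factor, so the extra \<open>\<rho>\<close> cancels against its conjugate and the twist is monoidal.\<close>

theorem quantum_isomorphic_if_twisted_frames:
  fixes d :: "'i::finite \<Rightarrow> 'g::ab_group_add" and d' :: "'j::finite \<Rightarrow> 'g"
  assumes X: "twisted_frame X A e d \<sigma> ev" and Y: "twisted_frame Y B f d' \<sigma>' ev"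
  shows "quantum_isomorphic X A Y B"
proof -
  note [simp del] = mult_matrix.simps op_matrix.simps unit_matrix.simps
  let ?\<rho> = "\<lambda>x y. \<sigma> x y * cnj (\<sigma>' x y)" and ?\<rho>' = "\<lambda>x y. \<sigma>' x y * cnj (\<sigma> x y)"
  let ?\<gamma> = "inv d \<circ> d'" and ?\<beta> = "inv d' \<circ> d"
  have bij: "bij d" "bij d'" using X Y by (auto simp: twisted_frame_def)
  then have \<gamma>: "bij ?\<gamma>" and \<beta>: "bij ?\<beta>"
    by (auto intro: bij_comp bij_imp_bij_inv)
  have d\<gamma>: "d (?\<gamma> j) = d' j" and d'\<beta>: "d' (?\<beta> i) = d i" for i j
    using bij by (simp_all add: bij_is_surj surj_f_inv_f)
  have \<beta>\<gamma>: "?\<beta> (?\<gamma> j) = j" and \<gamma>\<beta>: "?\<gamma> (?\<beta> i) = i" for i j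
    using bij by (simp_all add: bij_is_surj surj_f_inv_f bij_is_inj)
  have s: "unitary_bicharacter \<sigma>" and s': "unitary_bicharacter \<sigma>'"
    using X Y by (auto simp: twisted_frame_def)
  have b\<rho>: "unitary_bicharacter ?\<rho>" by (rule unitary_bicharacter_mult_cnj[OF s s'])
  note bs = unitary_bicharacterD[OF s] and bs' = unitary_bicharacterD[OF s']
    and b = unitary_bicharacterD[OF b\<rho>]
  let ?\<omega> = "\<lambda>a. ordered_phase ?\<rho> (map d' a)" and ?\<omega>' = "\<lambda>a. ordered_phase ?\<rho>' (map d a)"
  have one: "?\<omega> a * cnj (?\<omega> a) = 1" "cnj (?\<omega> a) * ?\<omega> a = 1" for a
    using ordered_phase_unit[OF b\<rho>] by (simp_all add: mult.commute)
  let ?F = "\<lambda>(k::nat) (l::nat). twist_matrix ?\<rho> d' ?\<gamma> :: 'i tmatrix \<Rightarrow> 'j tmatrix"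
    and ?G = "\<lambda>(k::nat) (l::nat). twist_matrix ?\<rho>' d ?\<beta> :: 'j tmatrix \<Rightarrow> 'i tmatrix"
  have \<omega>': "?\<omega>' a = cnj (?\<omega> (map ?\<beta> a))" for a
    unfolding ordered_phase_cnj[symmetric] using d'\<beta> by (simp add: comp_def mult.commute)
  have \<omega>'2: "?\<omega>' (map ?\<gamma> a) = cnj (?\<omega> a)" for a
    unfolding \<omega>' by (simp add: \<beta>\<gamma>[unfolded comp_def] comp_def)
  have GF: "?G k l (?F k l T) = T" for k l :: nat and T
  proof (intro ext)
    fix a b
    have "map ?\<gamma> (map ?\<beta> c) = c" for c using \<gamma>\<beta> by (simp add: comp_def)
    then have "?G k l (?F k l T) a b = (?\<omega> (map ?\<beta> a) * cnj (?\<omega> (map ?\<beta> a))) * T a b *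
        (?\<omega> (map ?\<beta> b) * cnj (?\<omega> (map ?\<beta> b)))"
      unfolding twist_matrix_def \<omega>' by (simp only: complex_cnj_cnj mult_ac)
    then show "?G k l (?F k l T) a b = T a b" by (simp only: one mult_1 mult_1_right)
  qed
  have FG: "?F k l (?G k l T) = T" for k l :: nat and T
  proof (intro ext)
    fix a b
    have "map ?\<beta> (map ?\<gamma> c) = c" for c using \<beta>\<gamma> by (simp add: comp_def)
    then have "?F k l (?G k l T) a b = (?\<omega> a * cnj (?\<omega> a)) * T a b * (?\<omega> b * cnj (?\<omega> b))"
      unfolding twist_matrix_def \<omega>'2 by (simp only: complex_cnj_cnj mult_ac)
    then show "?F k l (?G k l T) a b = T a b" by (simp only: one mult_1 mult_1_right)
  qed
  have "monoidal_dagger_iso (intertwiners X A e) (intertwiners Y B f) ?F"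
    unfolding monoidal_dagger_iso_def
  proof (intro conjI allI ballI)
    fix k l
    show "bij_betw (?F k l) (intertwiners X A e k l) (intertwiners Y B f k l)"
      by (rule bij_betw_byWitness[where f' = "?G k l"])
         (use GF FG twist_intertwiner[OF X Y \<gamma> d\<gamma> refl] twist_intertwiner[OF Y X \<beta> d'\<beta> refl]
           in \<open>auto simp del: o_apply\<close>)
  next
    fix k l S T
    show "?F k l (\<lambda>a b. S a b + T a b) = (\<lambda>a b. ?F k l S a b + ?F k l T a b)"
      by (simp add: twist_matrix_def algebra_simps)
  next
    fix k l z T
    show "?F k l (\<lambda>a b. z * T a b) = (\<lambda>a b. z * ?F k l T a b)"
      by (simp add: twist_matrix_def algebra_simps)
  next
    fix k
    have "map ?\<gamma> a = map ?\<gamma> b \<longleftrightarrow> a = b" for a b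
      using \<gamma> by (simp add: inj_map_eq_map bij_is_inj del: o_apply)
    then show "?F k k (tid k) = tid k"
      using one(2) by (auto simp: twist_matrix_def tid_def fun_eq_iff simp del: o_apply map_map)
  next
    fix k l n S T
    show "?F k n (tcomp l T S) = tcomp l (?F l n T) (?F k l S)"
    proof (intro ext)
      fix a b
      have "?F k n (tcomp l T S) a b = (\<Sum>c | length c = l.
          cnj (?\<omega> a) * (T (map ?\<gamma> a) (map ?\<gamma> c) * S (map ?\<gamma> c) (map ?\<gamma> b)) * ?\<omega> b)"
        unfolding twist_matrix_def tcomp_def sum_distrib_left[symmetric] sum_distrib_right[symmetric]
        by (subst sum_lists_bij[OF \<gamma>]) simp
      also have "\<dots> = (\<Sum>c | length c = l. (cnj (?\<omega> a) * T (map ?\<gamma> a) (map ?\<gamma> c) * ?\<omega> c) *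
          (cnj (?\<omega> c) * S (map ?\<gamma> c) (map ?\<gamma> b) * ?\<omega> b))"
      proof (rule sum.cong[OF refl])
        fix c
        have "(cnj (?\<omega> a) * T (map ?\<gamma> a) (map ?\<gamma> c) * ?\<omega> c) *
            (cnj (?\<omega> c) * S (map ?\<gamma> c) (map ?\<gamma> b) * ?\<omega> b) = (?\<omega> c * cnj (?\<omega> c)) *
            (cnj (?\<omega> a) * (T (map ?\<gamma> a) (map ?\<gamma> c) * S (map ?\<gamma> c) (map ?\<gamma> b)) * ?\<omega> b)"
          by (simp only: mult_ac)
        then show "cnj (?\<omega> a) * (T (map ?\<gamma> a) (map ?\<gamma> c) * S (map ?\<gamma> c) (map ?\<gamma> b)) * ?\<omega> b =
            (cnj (?\<omega> a) * T (map ?\<gamma> a) (map ?\<gamma> c) * ?\<omega> c) *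
            (cnj (?\<omega> c) * S (map ?\<gamma> c) (map ?\<gamma> b) * ?\<omega> b)" by (simp only: one mult_1)
      qed
      finally show "?F k n (tcomp l T S) a b = tcomp l (?F l n T) (?F k l S) a b"
        by (simp only: tcomp_def twist_matrix_def)
    qed
  next
    fix k l k' l' S T
    assume S: "S \<in> intertwiners X A e k l" and T: "T \<in> intertwiners X A e k' l'"
    show "?F (k + k') (l + l') (ttensor k l S T) = ttensor k l (?F k l S) (?F k' l' T)"
    proof (intro ext)
      fix a b :: "'j list"
      let ?a = "take l a" and ?a' = "drop l a" and ?b = "take k b" and ?b' = "drop k b"
      let ?S = "S (map ?\<gamma> ?a) (map ?\<gamma> ?b)" and ?T = "T (map ?\<gamma> ?a') (map ?\<gamma> ?b')"
      have split: "?\<omega> c = ?\<rho> (sum_list (map d' (take n c))) (sum_list (map d' (drop n c))) *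
          ?\<omega> (take n c) * ?\<omega> (drop n c)" for n c
        using ordered_phase_append[OF b\<rho>, of "map d' (take n c)" "map d' (drop n c)"]
        by (simp add: map_append[symmetric] del: map_append)
      have map: "map d (map ?\<gamma> c) = map d' c" for c using d\<gamma> by (simp add: comp_def)
      show "?F (k + k') (l + l') (ttensor k l S T) a b = ttensor k l (?F k l S) (?F k' l' T) a b"
      proof (cases "?S = 0 \<or> ?T = 0")
        case True
        then show ?thesis by (auto simp: twist_matrix_def ttensor_def take_map drop_map)
      next
        case False
        then have "sum_list (map d (map ?\<gamma> ?a)) = sum_list (map d (map ?\<gamma> ?b))"
          "sum_list (map d (map ?\<gamma> ?a')) = sum_list (map d (map ?\<gamma> ?b'))"
          using intertwiner_graded[OF X S] intertwiner_graded[OF X T] by blast+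
        then have deg: "sum_list (map d' ?a) = sum_list (map d' ?b)"
          "sum_list (map d' ?a') = sum_list (map d' ?b')" unfolding map .
        \<comment> \<open>As degrees agree, row phase and column phase contain the same factor \<open>\<rho>\<close>, once conjugated.\<close>
        let ?r = "?\<rho> (sum_list (map d' ?b)) (sum_list (map d' ?b'))"
        have "?F (k + k') (l + l') (ttensor k l S T) a b =
            (cnj ?r * ?r) * ((cnj (?\<omega> ?a) * ?S * ?\<omega> ?b) * (cnj (?\<omega> ?a') * ?T * ?\<omega> ?b'))"
          unfolding twist_matrix_def ttensor_def split[of a l] split[of b k] deg
          by (simp only: take_map drop_map complex_cnj_mult complex_cnj_cnj mult_ac)
        also have "cnj ?r * ?r = 1" by (rule b(4))
        finally show ?thesis by (simp only: mult_1 twist_matrix_def ttensor_def)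
      qed
    qed
  next
    fix k l T
    show "?F l k (tdagger T) = tdagger (?F k l T)"
      by (simp add: twist_matrix_def tdagger_def mult_ac)
  qed
  moreover have "?F 1 1 (op_matrix X e A) = op_matrix Y f B"
  proof (rule twist_matrix_eqI[of 1 1])
    fix a b :: "'j list" assume "(length a, length b) = (1, 1)"
    then obtain i j where "a = [i]" "b = [j]" by (auto simp: length_Suc_conv)
    moreover have "?\<gamma> i = ?\<gamma> j \<longleftrightarrow> i = j" using \<gamma> by (metis bij_def inj_eq)
    then have "op_matrix X e A [?\<gamma> i] [?\<gamma> j] = op_matrix Y f B [i] [j]"
      using X Y d\<gamma> unfolding twisted_frame_def by metis
    ultimately show "twist_matrix ?\<rho> d' ?\<gamma> (op_matrix X e A) a b = op_matrix Y f B a b"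
      by (simp add: twist_matrix_def bs bs' del: o_apply)
  qed (auto dest: op_matrix_shape)
  moreover have "?F 2 1 (mult_matrix X e) = mult_matrix Y f"
  proof (rule twist_matrix_eqI[of 1 2])
    fix a b :: "'j list" assume "(length a, length b) = (1, 2)"
    then obtain k i j where ab: "a = [k]" "b = [i, j]"
      by (auto simp: length_Suc_conv numeral_2_eq_2)
    let ?x = "d' i" and ?y = "d' j"
    have "mult_matrix X e [?\<gamma> k] [?\<gamma> i, ?\<gamma> j] =
        (if d' k = ?x + ?y then cnj (\<sigma> ?x ?y) / sqrt (real CARD('g)) else 0)"
      and "mult_matrix Y f [k] [i, j] =
        (if d' k = ?x + ?y then cnj (\<sigma>' ?x ?y) / sqrt (real CARD('g)) else 0)"
      using X Y d\<gamma> unfolding twisted_frame_def by metis+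
    moreover have "cnj (\<sigma> ?x ?y) * (\<sigma> ?x ?y * cnj (\<sigma>' ?x ?y)) = cnj (\<sigma>' ?x ?y)"
      using bs(4)[of ?x ?y] by (simp add: mult.assoc[symmetric])
    ultimately show "twist_matrix ?\<rho> d' ?\<gamma> (mult_matrix X e) a b = mult_matrix Y f a b"
      unfolding ab by (simp add: twist_matrix_def bs bs' del: o_apply)
  qed (auto dest: mult_matrix_shape)
  moreover have "?F 0 1 (unit_matrix X e) = unit_matrix Y f"
  proof (rule twist_matrix_eqI[of 1 0])
    fix a b :: "'j list" assume "(length a, length b) = (1, 0)"
    then obtain i where "a = [i]" "b = []" by (auto simp: length_Suc_conv)
    moreover have "unit_matrix X e [?\<gamma> i] [] = unit_matrix Y f [i] []"
      using X Y d\<gamma> unfolding twisted_frame_def by metis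
    ultimately show "twist_matrix ?\<rho> d' ?\<gamma> (unit_matrix X e) a b = unit_matrix Y f a b"
      by (simp add: twist_matrix_def bs bs' del: o_apply)
  qed (auto dest: unit_matrix_shape)
  ultimately show ?thesis
    using X Y unfolding quantum_isomorphic_def twisted_frame_def by blast
qed


section \<open>The quantum set of two-by-two matrices in coordinates\<close>

lemma sum_UNIV_prod: "(\<Sum>p\<in>UNIV. g p) = (\<Sum>a\<in>UNIV. \<Sum>b\<in>UNIV. g (a :: 'a::finite, b :: 'b::finite))"
  unfolding UNIV_Times_UNIV[symmetric] sum.cartesian_product by simp

lemma sum_if_const: "(\<Sum>x\<in>S. if Q then g x else 0) = (if Q then \<Sum>x\<in>S. g x else 0)"
  by simp

lemma M2_mult_nth: "qmult M2 x y $ (a, b) = (\<Sum>c\<in>UNIV. x $ (a, c) * y $ (c, b))"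
  by (simp add: M2_def)

lemma M2_star_nth: "qstar M2 x $ (a, b) = cnj (x $ (b, a))"
  by (simp add: M2_def)

lemma M2_one_nth: "qone M2 $ (a, b) = (if a = b then 1 else 0)"
  by (simp add: M2_def)

lemma M2_counit: "qcounit M2 x = 2 * (\<Sum>a\<in>UNIV. x $ (a, a))"
  by (simp add: M2_def)

lemmas M2_nth = M2_mult_nth M2_star_nth M2_one_nth

lemma vec_pair_eqI: "(\<And>a b. x $ (a, b) = y $ (a, b)) \<Longrightarrow> x = y"
  by (simp add: vec_eq_iff split_paired_all)

lemma M2_inner: "qinner M2 x y = 2 * (\<Sum>a\<in>UNIV. \<Sum>b\<in>UNIV. cnj (x $ (a, b)) * y $ (a, b))"
  unfolding qinner_def M2_counit M2_nth by (subst sum.swap) simp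

lemma axis_pair_nth: "axis (i, j) z $ (k, l) = (if i = k then if j = l then z else 0 else 0)"
  by (simp add: axis_def)

lemma mult_if_zero:
  "x * (if Q then y else 0) = (if Q then x * y else (0 :: complex))"
  "(if Q then y else 0) * x = (if Q then y * x else (0 :: complex))"
  "cnj (if Q then y else 0) = (if Q then cnj y else 0)"
  by simp_all

lemmas delta_simps = sum_UNIV_prod mult_if_zero sum_if_const

lemma M2_mult_add_left: "qmult M2 (x + y) z = qmult M2 x z + qmult M2 y z"
  by (rule vec_pair_eqI) (simp add: M2_nth distrib_right sum.distrib)

lemma M2_mult_add_right: "qmult M2 z (x + y) = qmult M2 z x + qmult M2 z y"
  by (rule vec_pair_eqI) (simp add: M2_nth distrib_left sum.distrib)

lemma M2_mult_scale_left: "qmult M2 (c *s x) y = c *s qmult M2 x y"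
  by (rule vec_pair_eqI) (simp add: M2_nth sum_distrib_left mult_ac)

lemma M2_mult_scale_right: "qmult M2 x (c *s y) = c *s qmult M2 x y"
  by (rule vec_pair_eqI) (simp add: M2_nth sum_distrib_left mult_ac)

lemma M2_mult_minus: "qmult M2 (- x) y = - qmult M2 x y" "qmult M2 x (- y) = - qmult M2 x y"
  using M2_mult_scale_left[of "- 1" x y] M2_mult_scale_right[of x "- 1" y] by simp_all

lemma M2_mult_assoc: "qmult M2 (qmult M2 x y) z = qmult M2 x (qmult M2 y z)"
  by (rule vec_pair_eqI) (simp add: M2_nth sum_2 algebra_simps)

lemma M2_mult_one: "qmult M2 (qone M2) x = x" "qmult M2 x (qone M2) = x"
  by (rule vec_pair_eqI; simp add: M2_nth mult_if_zero if_distrib if_distribR cong: if_cong)+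

lemma M2_mult_sum_left: "qmult M2 (\<Sum>i\<in>I. x i) y = (\<Sum>i\<in>I. qmult M2 (x i) y)"
  by (induction I rule: infinite_finite_induct)
     (use M2_mult_scale_left[of 0] in \<open>simp_all add: M2_mult_add_left\<close>)

lemma M2_mult_sum_right: "qmult M2 y (\<Sum>i\<in>I. x i) = (\<Sum>i\<in>I. qmult M2 y (x i))"
  by (induction I rule: infinite_finite_induct)
     (use M2_mult_scale_right[of _ 0] in \<open>simp_all add: M2_mult_add_right\<close>)

lemma M2_star_add: "qstar M2 (x + y) = qstar M2 x + qstar M2 y"
  by (rule vec_pair_eqI) (simp add: M2_nth)

lemma M2_star_scale: "qstar M2 (c *s x) = cnj c *s qstar M2 x"
  by (rule vec_pair_eqI) (simp add: M2_nth)

lemma M2_star_sum: "qstar M2 (\<Sum>i\<in>I. x i) = (\<Sum>i\<in>I. qstar M2 (x i))"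
  by (induction I rule: infinite_finite_induct)
     (use M2_star_scale[of 0] in \<open>simp_all add: M2_star_add\<close>)

lemma M2_star_mult: "qstar M2 (qmult M2 x y) = qmult M2 (qstar M2 y) (qstar M2 x)"
  by (rule vec_pair_eqI) (simp add: M2_nth mult.commute)

lemma M2_star_one: "qstar M2 (qone M2) = qone M2"
  by (rule vec_pair_eqI) (simp add: M2_nth)

lemma M2_inner_add: "qinner M2 x (y + z) = qinner M2 x y + qinner M2 x z"
  by (simp add: M2_inner distrib_left sum.distrib)

lemma M2_inner_scale: "qinner M2 x (c *s y) = c * qinner M2 x y"
  by (simp add: M2_inner sum_distrib_left mult_ac)

lemma M2_mult_axis:
  "qmult M2 (axis (i, j) 1) (axis (k, l) 1) $ (a, b) =
     (if i = a then if j = k then if l = b then 1 else 0 else 0 else 0)"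
  by (simp add: M2_nth axis_pair_nth delta_simps)

lemma M2_env_mult_nth:
  "env_mult M2 S T $ ((a, b), (c, d)) =
     (\<Sum>m\<in>UNIV. \<Sum>n\<in>UNIV. S $ ((a, m), (n, d)) * T $ ((m, b), (c, n)))"
  unfolding env_mult_def
  by (simp add: delta_simps pure_tensor_def M2_mult_axis)

lemma M2_env_star_nth:
  "env_star M2 S $ ((a, b), (c, d)) = cnj (S $ ((b, a), (d, c)))"
  unfolding env_star_def
  by (simp add: delta_simps pure_tensor_def M2_nth axis_pair_nth M2_inner sum_distrib_left)

lemma M2_adjacency_nth:
  "adjacency M2 P x $ (a, b) = 2 * (\<Sum>c\<in>UNIV. \<Sum>d\<in>UNIV. P $ ((a, b), (c, d)) * x $ (d, c))"
  unfolding adjacency_def M2_counit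
  by (simp add: delta_simps pure_tensor_def M2_nth axis_pair_nth M2_inner sum_distrib_left mult.left_commute)

lemma M2_tensor_inner:
  "tensor_inner M2 S T =
     4 * (\<Sum>a\<in>UNIV. \<Sum>b\<in>UNIV. \<Sum>c\<in>UNIV. \<Sum>d\<in>UNIV.
            cnj (S $ ((a, b), (c, d))) * T $ ((a, b), (c, d)))"
proof -
  have inner: "qinner M2 (axis (a, b) 1) (axis (c, d) 1) = (if a = c then if b = d then 2 else 0 else 0)"
    for a b c d :: 2
    by (simp add: delta_simps pure_tensor_def M2_nth axis_pair_nth M2_inner sum_distrib_left)
  show ?thesis
    unfolding tensor_inner_def
    by (simp add: delta_simps inner sum_distrib_left)
qed

lemma M2_tensor_mult_nth:
  "tensor_mult M2 T $ (a, d) = (\<Sum>b\<in>UNIV. T $ ((a, b), (b, d)))"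
  unfolding tensor_mult_def
  by (simp add: delta_simps M2_mult_axis)


lemma vec_pair_pair_eqI: "(\<And>a b c d. S $ ((a, b), (c, d)) = T $ ((a, b), (c, d))) \<Longrightarrow> S = T"
  by (simp add: vec_eq_iff split_paired_all)

text \<open>\<open>m\<^sup>\<dagger>(y)\<close> has entry \<open>\<delta>\<^sub>b\<^sub>c y\<^sub>a\<^sub>d / 2\<close> at \<open>((a, b), (c, d))\<close>: matrix units have squared norm \<open>2\<close> in \<open>l\<^sup>2\<close> and
  their tensors squared norm \<open>4\<close>.\<close>

lemma M2_loop_projection_nth:
  "loop_projection M2 $ ((a, b), (c, d)) = (if b = c then if a = d then 1 / 2 else 0 else 0)"
proof -
  define g :: "complex ^ (2 \<times> 2) \<Rightarrow> complex ^ ((2 \<times> 2) \<times> (2 \<times> 2))" where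
    "g y = (\<chi> p. if snd (fst p) = fst (snd p) then y $ (fst (fst p), snd (snd p)) / 2 else 0)" for y
  have g: "g y $ ((a, b), (c, d)) = (if b = c then y $ (a, d) / 2 else 0)" for y a b c d
    by (simp add: g_def)
  have adjoint: "qinner M2 (tensor_mult M2 x) y = tensor_inner M2 x (g y)" for x y
    by (simp add: M2_tensor_inner M2_inner M2_tensor_mult_nth g sum_2 algebra_simps)
  have "hilbert_adjoint (tensor_inner M2) (qinner M2) (tensor_mult M2) = g"
    unfolding hilbert_adjoint_def
  proof (rule the_equality)
    show "\<forall>x y. qinner M2 (tensor_mult M2 x) y = tensor_inner M2 x (g y)"
      using adjoint by blast
  next
    fix g' assume g': "\<forall>x y. qinner M2 (tensor_mult M2 x) y = tensor_inner M2 x (g' y)"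
    have test: "tensor_inner M2 (axis ((a, b), (c, d)) 1) T = 4 * T $ ((a, b), (c, d))" for a b c d T
    proof -
      have "axis ((a, b), (c, d)) 1 $ ((a', b'), (c', d')) = (if a = a' then if b = b' then
          if c = c' then if d = d' then 1 else 0 else 0 else 0 else (0::complex))" for a' b' c' d'
        by (simp add: axis_def)
      then show ?thesis by (simp add: M2_tensor_inner mult_if_zero sum_if_const)
    qed
    have inner_g: "tensor_inner M2 x (g' y) = tensor_inner M2 x (g y)" for x y
      using adjoint g' by simp
    show "g' = g"
    proof (intro ext vec_pair_pair_eqI)
      fix y a b c d
      show "g' y $ ((a, b), (c, d)) = g y $ ((a, b), (c, d))"
        using inner_g[of "axis ((a, b), (c, d)) 1" y] by (simp add: test)
    qed
  qed
  then show ?thesis unfolding loop_projection_def by (simp add: g M2_one_nth)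
qed


section \<open>Edge projections as operators on two-by-two matrices\<close>

text \<open>The action of \<open>\<Sum> a \<otimes> b\<close> on \<open>M\<^sub>2\<close> by \<open>x \<mapsto> \<Sum> a x b\<close>; it identifies \<open>M\<^sub>2 \<otimes> M\<^sub>2\<^sup>o\<^sup>p\<close> with the operators on \<open>M\<^sub>2\<close>.\<close>

definition sandwich :: "complex ^ ((2 \<times> 2) \<times> (2 \<times> 2)) \<Rightarrow> complex ^ (2 \<times> 2) \<Rightarrow> complex ^ (2 \<times> 2)" where
  "sandwich P x = (\<chi> p. \<Sum>b\<in>UNIV. \<Sum>c\<in>UNIV. P $ ((fst p, b), (c, snd p)) * x $ (b, c))"

lemma sandwich_nth:
  "sandwich P x $ (a, d) = (\<Sum>b\<in>UNIV. \<Sum>c\<in>UNIV. P $ ((a, b), (c, d)) * x $ (b, c))"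
  by (simp add: sandwich_def)

lemma sandwich_add: "sandwich P (x + y) = sandwich P x + sandwich P y"
  by (rule vec_pair_eqI) (simp add: sandwich_nth distrib_left sum.distrib)

lemma sandwich_scale: "sandwich P (z *s x) = z *s sandwich P x"
  by (rule vec_pair_eqI) (simp add: sandwich_nth sum_distrib_left mult_ac)

lemma sandwich_sum: "sandwich P (\<Sum>i\<in>I. x i) = (\<Sum>i\<in>I. sandwich P (x i))"
proof (induction I rule: infinite_finite_induct)
  case empty
  show ?case using sandwich_scale[of P 0 0] by simp
next
  case (infinite I)
  then show ?case using sandwich_scale[of P 0 0] by simp
qed (simp add: sandwich_add)

lemma sandwich_axis: "sandwich P (axis (b, c) 1) $ (a, d) = P $ ((a, b), (c, d))"
  by (simp add: sandwich_nth axis_pair_nth mult_if_zero sum_if_const)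

lemma sandwich_sandwich: "sandwich S (sandwich T x) = sandwich (env_mult M2 S T) x"
proof (rule vec_pair_eqI)
  fix a d
  have "sandwich S (sandwich T x) $ (a, d) = (\<Sum>b\<in>UNIV. \<Sum>c\<in>UNIV. \<Sum>m\<in>UNIV. \<Sum>n\<in>UNIV.
      S $ ((a, b), (c, d)) * T $ ((b, m), (n, c)) * x $ (m, n))"
    by (simp add: sandwich_nth sum_distrib_left mult.assoc)
  also have "\<dots> = sandwich (env_mult M2 S T) x $ (a, d)"
    by (simp add: sandwich_nth M2_env_mult_nth sum_2 algebra_simps)
  finally show "sandwich S (sandwich T x) $ (a, d) = sandwich (env_mult M2 S T) x $ (a, d)" .
qed

lemma sandwich_adjoint:
  assumes "env_star M2 P = P"
  shows "qinner M2 (sandwich P x) y = qinner M2 x (sandwich P y)"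
proof -
  have "cnj (P $ ((a, b), (c, d))) = P $ ((b, a), (d, c))" for a b c d
    using assms M2_env_star_nth[of P b a d c] by simp
  then show ?thesis by (simp add: M2_inner sandwich_nth sum_2 algebra_simps)
qed

text \<open>For self-adjoint \<open>P = \<Sum> a \<otimes> b\<close> one has \<open>(\<Sum> a x\<^sup>* b)\<^sup>* = \<Sum> b\<^sup>* x a\<^sup>* = \<Sum> b x a\<close>, which is the action on \<open>x\<close> of the
  swapped element.\<close>

lemma sandwich_star:
  assumes "env_star M2 P = P" and "tensor_swap P = P"
  shows "sandwich P (qstar M2 x) = qstar M2 (sandwich P x)"
proof -
  have "cnj (P $ ((a, b), (c, d))) = P $ ((b, a), (d, c))" for a b c d
    using assms(1) M2_env_star_nth[of P b a d c] by simp
  moreover have "P $ ((a, b), (c, d)) = P $ ((c, d), (a, b))" for a b c d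
    using arg_cong[OF assms(2), of "\<lambda>P. P $ ((a, b), (c, d))"] by (simp add: tensor_swap_def)
  ultimately have "cnj (P $ ((a, b), (c, d))) = P $ ((d, c), (b, a))" for a b c d by metis
  then show ?thesis
    by (intro vec_pair_eqI) (simp add: sandwich_nth M2_nth sum_2 algebra_simps)
qed

lemma sandwich_one:
  assumes "env_mult M2 P (loop_projection M2) = 0"
  shows "sandwich P (qone M2) = 0"
proof (rule vec_pair_eqI)
  fix a d
  have "env_mult M2 P (loop_projection M2) $ ((a, b), (b, d)) =
      (\<Sum>m\<in>UNIV. P $ ((a, m), (m, d))) / 2" for b
    by (simp add: M2_env_mult_nth M2_loop_projection_nth mult_if_zero sum_if_const sum_divide_distrib)
  then show "sandwich P (qone M2) $ (a, d) = 0 $ (a, d)"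
    using assms by (simp add: sandwich_nth M2_one_nth sum_2)
qed


section \<open>Traceless self-adjoint matrices as Euclidean three-space\<close>

text \<open>\<open>v\<^sub>1 \<sigma>\<^sub>1 + v\<^sub>2 \<sigma>\<^sub>2 + v\<^sub>3 \<sigma>\<^sub>3\<close> with the Pauli matrices \<open>\<sigma>\<^sub>i\<close>; the indices \<open>1\<close> and \<open>2\<close> are the elements of the
  two-element index type, in which \<open>2 = 0\<close>.\<close>

definition pauli :: "real ^ 3 \<Rightarrow> complex ^ (2 \<times> 2)" where
  "pauli v = (\<chi> p. if p = (1, 1) then of_real (v $ 3) else if p = (2, 2) then - of_real (v $ 3)
     else if p = (1, 2) then Complex (v $ 1) (- (v $ 2)) else Complex (v $ 1) (v $ 2))"

lemma pauli_nth:
  "pauli v $ (1, 1) = of_real (v $ 3)" "pauli v $ (2, 2) = - of_real (v $ 3)"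
  "pauli v $ (1, 2) = Complex (v $ 1) (- (v $ 2))" "pauli v $ (2, 1) = Complex (v $ 1) (v $ 2)"
  by (simp_all add: pauli_def)

lemma M2_eqI:
  fixes x y :: "complex ^ (2 \<times> 2)"
  assumes "x $ (1, 1) = y $ (1, 1)" "x $ (1, 2) = y $ (1, 2)"
    "x $ (2, 1) = y $ (2, 1)" "x $ (2, 2) = y $ (2, 2)"
  shows "x = y"
  using assms by (auto simp: vec_eq_iff split_paired_all forall_2)

lemma pauli_inject: "pauli v = pauli w \<longleftrightarrow> v = w"
proof
  assume "pauli v = pauli w"
  then have "pauli v $ (1, 1) = pauli w $ (1, 1)" "pauli v $ (2, 1) = pauli w $ (2, 1)" by simp_all
  then show "v = w" by (simp add: pauli_nth vec_eq_iff forall_3)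
qed simp

lemma pauli_add: "pauli (v + w) = pauli v + pauli w"
  by (rule M2_eqI) (simp_all add: pauli_nth complex_eq_iff)

lemma pauli_scale: "pauli (r *\<^sub>R v) = of_real r *s pauli v"
  by (rule M2_eqI) (simp_all add: pauli_nth complex_eq_iff)

lemma pauli_star: "qstar M2 (pauli v) = pauli v"
  by (rule M2_eqI) (simp_all add: M2_nth pauli_nth complex_eq_iff)


lemma pauli_inner: "qinner M2 (pauli v) (pauli w) = 4 * of_real (v \<bullet> w)"
  by (simp add: M2_inner sum_2 pauli_nth inner_vec_def sum_3 complex_eq_iff algebra_simps)

lemma pauli_mult_anticommute:
  "qmult M2 (pauli v) (pauli w) + qmult M2 (pauli w) (pauli v) = (2 * of_real (v \<bullet> w)) *s qone M2"
  by (rule M2_eqI)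
     (simp_all add: M2_nth sum_2 pauli_nth inner_vec_def sum_3 complex_eq_iff algebra_simps)

lemma pauli_surj:
  assumes "qstar M2 x = x" and "qinner M2 (qone M2) x = 0"
  shows "\<exists>v. x = pauli v"
proof -
  have "cnj (x $ (b, a)) = x $ (a, b)" for a b
    using arg_cong[OF assms(1), of "\<lambda>x. x $ (a, b)"] by (simp add: M2_nth)
  from this[of 1 1] this[of 1 2] this[of 2 1] this[of 2 2] assms(2)
  have "x = pauli (vector [Re (x $ (2, 1)), Im (x $ (2, 1)), Re (x $ (1, 1))])"
    by (intro M2_eqI) (auto simp: pauli_nth M2_inner M2_nth sum_2 complex_eq_iff)
  then show ?thesis ..
qed

text \<open>Orthonormal bases of the range and of the kernel together form an orthonormal basis of the space.\<close>

lemma orthogonal_projection_eigenbasis: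
  fixes Q :: "'a::euclidean_space \<Rightarrow> 'a"
  assumes Q: "linear Q" "\<And>v. Q (Q v) = Q v" "\<And>v w. Q v \<bullet> w = v \<bullet> Q w"
  obtains B where "finite B" "card B = DIM('a)" "span B = UNIV" "pairwise orthogonal B"
    "\<And>v. v \<in> B \<Longrightarrow> norm v = 1" "\<And>v. v \<in> B \<Longrightarrow> Q v = v \<or> Q v = 0"
proof -
  have W: "subspace (range Q)" using Q(1) by (simp add: linear_subspace_image)
  have K: "subspace {v. Q v = 0}" using Q(1) by (rule linear_subspace_kernel)
  obtain B1 where B1: "B1 \<subseteq> range Q" "pairwise orthogonal B1" "\<And>x. x \<in> B1 \<Longrightarrow> norm x = 1"
    "independent B1" "span B1 = range Q" using orthonormal_basis_subspace[OF W] by metis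
  obtain B2 where B2: "B2 \<subseteq> {v. Q v = 0}" "pairwise orthogonal B2" "\<And>x. x \<in> B2 \<Longrightarrow> norm x = 1"
    "independent B2" "span B2 = {v. Q v = 0}" using orthonormal_basis_subspace[OF K] by metis
  have perp: "x \<bullet> y = 0" if "x \<in> B1" "y \<in> B2" for x y
  proof -
    obtain z where "x = Q z" using \<open>x \<in> B1\<close> B1(1) by blast
    then have "x \<bullet> y = z \<bullet> Q y" by (simp add: Q(3))
    then show ?thesis using \<open>y \<in> B2\<close> B2(1) by auto
  qed
  let ?B = "B1 \<union> B2"
  have orth: "pairwise orthogonal ?B"
    using B1(2) B2(2) perp perp[THEN inner_commute[THEN trans]]
    by (auto simp: pairwise_def orthogonal_def)
  have norm: "norm v = 1" if "v \<in> ?B" for v using that B1(3) B2(3) by blast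
  have ind: "independent ?B"
    using orth norm[of 0] by (intro pairwise_orthogonal_independent) auto
  have span: "span ?B = UNIV"
  proof (intro set_eqI iffI UNIV_I)
    fix v
    have "Q v \<in> span B1" using B1(5) by blast
    moreover have "v - Q v \<in> span B2" using B2(5) Q by (simp add: linear_diff)
    ultimately have "Q v + (v - Q v) \<in> span ?B"
      by (intro span_add) (meson span_mono sup_ge1 sup_ge2 subsetD)+
    then show "v \<in> span ?B" by simp
  qed
  have "card ?B = DIM('a)"
    using dim_eq_card_independent[OF ind] dim_span[of ?B] by (simp add: span)
  moreover have "Q v = v \<or> Q v = 0" if "v \<in> ?B" for v
    using that B1(1) B2(1) Q(2) by auto
  ultimately show thesis
    using that[of ?B] orth norm span ind independent_imp_finite by blast
qed

text \<open>The matrices \<open>1\<close> and \<open>V\<^sub>v\<close>, for \<open>v\<close> in an orthonormal basis of \<open>\<real>\<^sup>3\<close>, form an orthogonal basis of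
  \<open>M\<^sub>2\<close>; this is the expansion of the matrix units in it (the Fierz identity for the Pauli matrices).\<close>

lemma pauli_completeness:
  fixes B :: "(real ^ 3) set"
  assumes B: "finite B" "span B = UNIV" "pairwise orthogonal B" "\<And>v. v \<in> B \<Longrightarrow> norm v = 1"
  shows "axis (b, c) 1 = (if b = c then 1 / 2 else 0) *s qone M2 +
    (\<Sum>v\<in>B. (pauli v $ (c, b) / 2) *s pauli v)"
proof -
  have dual: "(\<Sum>v\<in>B. v $ i * v $ j) = (if i = j then 1 else 0)" for i j
  proof -
    have "(\<Sum>v\<in>B. (axis i 1 \<bullet> v) *\<^sub>R v) = axis i 1"
      using B by (intro orthonormal_basis_expand) auto
    then have "(\<Sum>v\<in>B. (axis i 1 \<bullet> v) *\<^sub>R v) $ j = axis i 1 $ j" by simp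
    then show ?thesis by (simp add: inner_axis') (simp add: axis_def eq_commute)
  qed
  have s: "(\<Sum>v\<in>B. v $ i * v $ i) = 1" for i using dual[of i i] by simp
  have o: "i \<noteq> j \<Longrightarrow> (\<Sum>v\<in>B. v $ i * v $ j) = 0" for i j using dual[of i j] by simp
  have "(b = 1 \<or> b = 2) \<and> (c = 1 \<or> c = 2)" using exhaust_2 by blast
  then show ?thesis
    by (elim conjE disjE; intro M2_eqI)
       (simp_all add: pauli_nth axis_pair_nth M2_nth complex_eq_iff
           sum_divide_distrib[symmetric] sum_distrib_left[symmetric] sum.distrib sum_negf sum_subtractf s o mult.commute)
qed


text \<open>In an eigenbasis of the projection induced on \<open>\<real>\<^sup>3\<close>, the operator \<open>x \<mapsto> \<Sum> a x b\<close> of the edge projection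
  is \<open>x \<mapsto> \<Sum> \<open>tr\<close>(V\<^sub>v x) V\<^sub>v / 2\<close> over the eigenvectors \<open>v\<close> of eigenvalue \<open>1\<close>. Rearranging the indices of
  this operator turns it into the adjacency matrix \<open>x \<mapsto> \<Sum> V\<^sub>v x V\<^sub>v\<close>.\<close>

lemma simple_quantum_graph_M2_pauli_form:
  assumes "simple_quantum_graph M2 A"
  obtains B K where "finite B" "card B = 3" "pairwise orthogonal B" "\<forall>v\<in>B. norm v = 1"
    "K \<subseteq> B" "A = (\<lambda>x. \<Sum>v\<in>K. qmult M2 (qmult M2 (pauli v) x) (pauli v))"
proof -
  obtain P where P: "env_mult M2 P P = P" "env_star M2 P = P" "tensor_swap P = P"
      "env_mult M2 P (loop_projection M2) = 0" and A: "A = adjacency M2 P"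
    using assms by (auto simp: simple_quantum_graph_def env_projection_def)
  have ex: "\<exists>w. sandwich P (pauli v) = pauli w" for v
  proof (rule pauli_surj)
    show "qstar M2 (sandwich P (pauli v)) = sandwich P (pauli v)"
      using sandwich_star[OF P(2,3), of "pauli v"] by (simp add: pauli_star)
    have "qinner M2 (qone M2) (sandwich P (pauli v)) = qinner M2 (sandwich P (qone M2)) (pauli v)"
      by (rule sandwich_adjoint[OF P(2), symmetric])
    then show "qinner M2 (qone M2) (sandwich P (pauli v)) = 0"
      by (simp add: sandwich_one[OF P(4)] M2_inner)
  qed
  then obtain Q where Q: "\<And>v. sandwich P (pauli v) = pauli (Q v)" by metis
  have "linear Q"
    by (rule linearI; rule pauli_inject[THEN iffD1])
       (simp_all add: Q[symmetric] pauli_add pauli_scale sandwich_add sandwich_scale)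
  moreover have "Q (Q v) = Q v" for v
    by (rule pauli_inject[THEN iffD1]) (simp add: Q[symmetric] sandwich_sandwich P(1))
  moreover have "Q v \<bullet> w = v \<bullet> Q w" for v w
  proof -
    have "complex_of_real (Q v \<bullet> w) = of_real (v \<bullet> Q w)"
      using sandwich_adjoint[OF P(2), of "pauli v" "pauli w"] by (simp add: Q pauli_inner)
    then show ?thesis by (simp only: of_real_eq_iff)
  qed
  ultimately obtain B where B: "finite B" "card B = DIM(real ^ 3)" "span B = UNIV"
    "pairwise orthogonal B" "\<And>v. v \<in> B \<Longrightarrow> norm v = 1" "\<And>v. v \<in> B \<Longrightarrow> Q v = v \<or> Q v = 0"
    using orthogonal_projection_eigenbasis[of Q] by blast
  define K where "K = {v \<in> B. Q v = v}"
  have zero: "pauli 0 = 0" using pauli_scale[of 0 0] by simp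
  have eigen: "sandwich P (pauli v) = (if v \<in> K then pauli v else 0)" if "v \<in> B" for v
    using B(6)[OF that] that by (auto simp: Q K_def zero)
  have P_pauli: "P $ ((a, b), (c, d)) = (\<Sum>v\<in>K. pauli v $ (a, d) * pauli v $ (c, b)) / 2" for a b c d
  proof -
    have axis: "axis (b, c) 1 = (if b = c then 1 / 2 else 0) *s qone M2 +
        (\<Sum>v\<in>B. (pauli v $ (c, b) / 2) *s pauli v)"
      using B by (intro pauli_completeness) auto
    have "sandwich P (axis (b, c) 1) = (\<Sum>v\<in>B. (pauli v $ (c, b) / 2) *s sandwich P (pauli v))"
      unfolding axis
      by (simp add: sandwich_add sandwich_scale sandwich_sum sandwich_one[OF P(4)])
    also have "\<dots> = (\<Sum>v\<in>B. if v \<in> K then (pauli v $ (c, b) / 2) *s pauli v else 0)"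
      by (rule sum.cong) (simp_all add: eigen)
    also have "\<dots> = (\<Sum>v\<in>K. (pauli v $ (c, b) / 2) *s pauli v)"
      using B(1) by (intro sum.mono_neutral_cong_right) (auto simp: K_def)
    finally have "sandwich P (axis (b, c) 1) $ (a, d) = \<dots> $ (a, d)" by simp
    then show ?thesis by (simp add: sandwich_axis sum_divide_distrib mult.commute)
  qed
  have "A x $ (a, b) = (\<Sum>v\<in>K. qmult M2 (qmult M2 (pauli v) x) (pauli v)) $ (a, b)" for x a b
  proof -
    have "A x $ (a, b) =
        (\<Sum>c\<in>UNIV. \<Sum>d\<in>UNIV. \<Sum>v\<in>K. pauli v $ (a, d) * pauli v $ (c, b) * x $ (d, c))"
      by (simp add: A M2_adjacency_nth P_pauli sum_distrib_left sum_distrib_right sum_divide_distrib)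
    also have "\<dots> = (\<Sum>v\<in>K. \<Sum>c\<in>UNIV. \<Sum>d\<in>UNIV. pauli v $ (a, d) * pauli v $ (c, b) * x $ (d, c))"
      by (simp add: sum_2 sum.distrib)
    also have "\<dots> = (\<Sum>v\<in>K. qmult M2 (qmult M2 (pauli v) x) (pauli v)) $ (a, b)"
      by (simp add: M2_mult_nth sum_2 algebra_simps)
    finally show ?thesis .
  qed
  then have "A = (\<lambda>x. \<Sum>v\<in>K. qmult M2 (qmult M2 (pauli v) x) (pauli v))"
    by (intro ext vec_pair_eqI)
  moreover have "K \<subseteq> B" by (simp add: K_def)
  ultimately show thesis using that[of B K] B by simp
qed


section \<open>Orthonormal families\<close>

text \<open>Orthonormality makes the coordinate map injective, and the number of vectors is the dimension.\<close>

lemma orthonormal_combinations: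
  fixes e :: "'i::finite \<Rightarrow> complex ^ 'i"
  assumes add: "\<And>x y z. qinner X x (y + z) = qinner X x y + qinner X x z"
    and scale: "\<And>x c y. qinner X x (c *s y) = c * qinner X x y"
    and orth: "\<And>i j. qinner X (e i) (e j) = (if i = j then 1 else 0)"
  shows "bij (\<lambda>c. \<Sum>i\<in>UNIV. c $ i *s e i)" and "orthonormal_basis X e"
proof -
  let ?\<psi> = "\<lambda>c. \<Sum>i\<in>UNIV. c $ i *s e i"
  have lin: "Vector_Spaces.linear (*s) (*s) ?\<psi>"
    by unfold_locales
       (simp_all add: vec.scale_left_distrib sum.distrib vec.scale_sum_right)
  have zero: "qinner X x 0 = 0" for x using scale[of x 0 0] by simp
  have sum: "qinner X x (\<Sum>i\<in>I. g i) = (\<Sum>i\<in>I. qinner X x (g i))" for x I and g :: "'i \<Rightarrow> _"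
    by (induction I rule: infinite_finite_induct) (simp_all add: zero add)
  have coord: "qinner X (e j) (?\<psi> c) = c $ j" for c j
    by (simp add: sum scale orth if_distrib cong: if_cong)
  have "inj ?\<psi>"
  proof (rule injI)
    fix c c' assume "?\<psi> c = ?\<psi> c'"
    then have "c $ j = c' $ j" for j using coord by metis
    then show "c = c'" by (simp add: vec_eq_iff)
  qed
  moreover from this have "surj ?\<psi>" using lin by (intro vec.linear_inj_imp_surj)
  ultimately show "bij ?\<psi>" by (simp add: bij_def)
  have "x \<in> vec.span (range e)" for x
  proof -
    obtain c where "x = ?\<psi> c" using \<open>surj ?\<psi>\<close> by blast
    moreover have "?\<psi> c \<in> vec.span (range e)"
      by (intro vec.span_sum vec.span_scale vec.span_base) auto
    ultimately show ?thesis by simp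
  qed
  then show "orthonormal_basis X e" using orth by (auto simp: orthonormal_basis_def)
qed


section \<open>Characters of finite abelian groups\<close>

lemma character_labellingD:
  fixes \<tau> :: "'g::{finite, ab_group_add} \<Rightarrow> 'g \<Rightarrow> complex"
  assumes "character_labelling \<tau>"
  shows "\<tau> \<mu> (x + y) = \<tau> \<mu> x * \<tau> \<mu> y" "\<tau> (\<mu> + \<nu>) x = \<tau> \<mu> x * \<tau> \<nu> x"
    "cnj (\<tau> \<mu> x) * \<tau> \<mu> x = 1" "\<tau> \<mu> x \<noteq> 0" "\<tau> 0 x = 1" "\<tau> (- \<mu>) x = cnj (\<tau> \<mu> x)" "inj \<tau>"
proof -
  let ?C = "{f :: 'g \<Rightarrow> complex. (\<forall>x. norm (f x) = 1) \<and> (\<forall>x y. f (x + y) = f x * f y)}"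
  have bij: "bij_betw \<tau> UNIV ?C" using assms by (simp add: character_labelling_def)
  then have "\<tau> \<mu> \<in> ?C" for \<mu> by (auto simp: bij_betw_def)
  then have norm: "norm (\<tau> \<mu> x) = 1" and hom: "\<tau> \<mu> (x + y) = \<tau> \<mu> x * \<tau> \<mu> y" for \<mu> x y by auto
  show "\<tau> \<mu> (x + y) = \<tau> \<mu> x * \<tau> \<mu> y" by (rule hom)
  show add: "\<tau> (\<mu> + \<nu>) x = \<tau> \<mu> x * \<tau> \<nu> x" for \<mu> \<nu> x
    using assms by (simp add: character_labelling_def)
  show one: "cnj (\<tau> \<mu> x) * \<tau> \<mu> x = 1" for \<mu> x
    using norm[of \<mu> x] by (simp add: complex_norm_square[symmetric] mult.commute)
  then show nz: "\<tau> \<mu> x \<noteq> 0" for \<mu> x by (metis mult_zero_right zero_neq_one)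
  show zero: "\<tau> 0 x = 1" using add[of 0 0 x] nz[of 0 x] by simp
  show "\<tau> (- \<mu>) x = cnj (\<tau> \<mu> x)"
    using add[of "- \<mu>" \<mu> x] zero one[of \<mu> x] nz[of \<mu> x] by (metis add.left_inverse mult_right_cancel)
  show "inj \<tau>" using bij by (simp add: bij_betw_def)
qed

text \<open>Translating by a point where the two characters differ multiplies the sum by a number other
  than \<open>1\<close>.\<close>

lemma character_orthogonality:
  fixes \<tau> :: "'g::{finite, ab_group_add} \<Rightarrow> 'g \<Rightarrow> complex"
  assumes "character_labelling \<tau>"
  shows "(\<Sum>x\<in>UNIV. cnj (\<tau> \<mu> x) * \<tau> \<nu> x) = (if \<mu> = \<nu> then of_nat CARD('g) else 0)"
proof (cases "\<mu> = \<nu>")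
  case False
  note c = character_labellingD[OF assms]
  obtain y where y: "\<tau> \<mu> y \<noteq> \<tau> \<nu> y" using False c(7) by (metis ext injD)
  let ?g = "\<lambda>x. cnj (\<tau> \<mu> x) * \<tau> \<nu> x"
  have "(\<Sum>x\<in>UNIV. ?g x) = (\<Sum>x\<in>UNIV. ?g (x + y))"
    by (rule sum.reindex_bij_betw[symmetric])
       (auto intro!: bij_betw_byWitness[where f' = "\<lambda>x. x - y"])
  also have "\<dots> = ?g y * (\<Sum>x\<in>UNIV. ?g x)"
    by (simp add: c(1) sum_distrib_left mult_ac)
  finally have "(1 - ?g y) * (\<Sum>x\<in>UNIV. ?g x) = 0" by (simp add: algebra_simps)
  moreover have "?g y \<noteq> 1"
    using y c(3)[of \<mu> y] c(4)[of \<mu> y] by (metis complex_cnj_zero_iff mult_left_cancel)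
  ultimately show ?thesis using False by simp
qed (simp add: character_labellingD(3)[OF assms])


section \<open>Classical Cayley graphs\<close>

definition function_qset :: "'i::finite qset" where
  "function_qset = \<lparr> qmult = (\<lambda>x y. \<chi> p. x $ p * y $ p), qone = (\<chi> p. 1),
     qstar = (\<lambda>x. \<chi> p. cnj (x $ p)), qcounit = (\<lambda>x. \<Sum>p\<in>UNIV. x $ p) \<rparr>"

lemma function_qset_nth:
  "qmult function_qset x y $ p = x $ p * y $ p" "qone function_qset $ p = 1"
  "qstar function_qset x $ p = cnj (x $ p)" "qcounit function_qset x = (\<Sum>p\<in>UNIV. x $ p)"
  by (simp_all add: function_qset_def)

lemma function_qset_inner: "qinner function_qset x y = (\<Sum>p\<in>UNIV. cnj (x $ p) * y $ p)"
  by (simp add: qinner_def function_qset_nth)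

lemma classical_function_qset: "classical function_qset"
  by (simp add: classical_def function_qset_def mult.commute)

text \<open>The functions on a finite set are the multimatrix algebra with all blocks of size \<open>1\<close>.\<close>

lemma finite_quantum_set_function_qset: "finite_quantum_set (function_qset :: 'i::finite qset)"
proof -
  obtain g :: "nat \<Rightarrow> 'i" where g: "bij_betw g {..<CARD('i)} UNIV"
    using ex_bij_betw_nat_finite[of "UNIV :: 'i set"] by (auto simp: atLeast0LessThan)
  let ?r = "CARD('i)" and ?n = "\<lambda>_ :: nat. 1 :: nat"
  let ?\<phi> = "\<lambda>x :: complex ^ 'i. (\<lambda>i a b. if i < ?r \<and> a = 0 \<and> b = 0 then x $ g i else 0) :: blocks"
  let ?h = "the_inv_into {..<?r} g"
  have h: "?h p < ?r" "g (?h p) = p" for p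
    using g the_inv_into_into[of g "{..<?r}" p "{..<?r}"] f_the_inv_into_f[of g "{..<?r}" p]
    by (auto simp: bij_betw_def)
  have hg: "i < ?r \<Longrightarrow> ?h (g i) = i" for i using g by (simp add: bij_betw_def the_inv_into_f_f)
  have "bij_betw ?\<phi> UNIV (multimatrix ?r ?n)"
    by (rule bij_betw_byWitness[where f' = "\<lambda>M. \<chi> p. M (?h p) 0 0"])
       (auto simp: vec_eq_iff h hg multimatrix_def fun_eq_iff split: if_splits)
  moreover have "qcounit function_qset x = block_counit ?r ?n (?\<phi> x)" for x
    using sum.reindex_bij_betw[OF g, of "\<lambda>p. x $ p"]
    by (simp add: function_qset_nth block_counit_def)
  ultimately show ?thesis
    unfolding finite_quantum_set_def
    by (intro exI[of _ ?r] exI[of _ ?n] exI[of _ ?\<phi>])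
       (auto simp: function_qset_nth block_mult_def block_one_def block_adjoint_def fun_eq_iff)
qed

text \<open>The points of the graph are group elements, enumerated by \<open>d\<close>; \<open>p\<close> and \<open>q\<close> are adjacent when
  they differ by an element of \<open>S\<close>.\<close>

definition classical_cayley ::
    "('i::finite \<Rightarrow> 'g::ab_group_add) \<Rightarrow> 'g set \<Rightarrow> complex ^ 'i \<Rightarrow> complex ^ 'i" where
  "classical_cayley d S x = (\<chi> p. \<Sum>q\<in>UNIV. of_bool (d p - d q \<in> S) * x $ q)"

lemma quantum_graph_classical_cayley: "quantum_graph function_qset (classical_cayley d S)"
proof -
  let ?P = "(\<chi> p. of_bool (d (fst p) - d (snd p) \<in> S)) :: complex ^ ('a \<times> 'a)"
  have axis: "axis i (1::complex) $ j = of_bool (j = i)" for i j :: 'a by (simp add: axis_def)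
  have delta: "(\<Sum>k\<in>UNIV. z k * of_bool (i = k)) = z i" "(\<Sum>k\<in>UNIV. of_bool (i = k) * z k) = z i"
    "(\<Sum>k\<in>UNIV. z k * of_bool (k = i)) = z i" "(\<Sum>k\<in>UNIV. of_bool (k = i) * z k) = z i"
    for z :: "'a \<Rightarrow> complex" and i by (simp_all add: of_bool_def if_distrib if_distribR cong: if_cong)
  have cnj: "cnj (of_bool b) = of_bool b" for b by (cases b) simp_all
  have "env_mult function_qset ?P ?P = ?P"
    unfolding vec_eq_iff env_mult_def
    by (simp add: pure_tensor_def function_qset_nth axis sum_UNIV_prod mult.assoc[symmetric] delta
         sum_distrib_left[symmetric] sum_distrib_right[symmetric])
  moreover have "env_star function_qset ?P = ?P"
    unfolding vec_eq_iff env_star_def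
    by (simp add: pure_tensor_def function_qset_nth axis cnj sum_UNIV_prod mult.assoc[symmetric] delta)
  moreover have "classical_cayley d S = adjacency function_qset ?P"
    unfolding adjacency_def fun_eq_iff vec_eq_iff classical_cayley_def
    by (simp add: function_qset_nth axis sum_UNIV_prod mult.assoc[symmetric] delta
         sum_distrib_left[symmetric] sum_distrib_right[symmetric])
  ultimately show ?thesis
    using finite_quantum_set_function_qset by (auto simp: quantum_graph_def env_projection_def)
qed

text \<open>The normalised characters form an orthonormal basis, are multiplied like group elements and are
  eigenvectors of every translation-invariant operator.\<close>

lemma classical_cayley_frame:
  fixes d :: "'i::finite \<Rightarrow> 'g::{finite, ab_group_add}"
  assumes \<tau>: "character_labelling \<tau>" and d: "bij d"
  shows "twisted_frame function_qset (classical_cayley d S)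
    (\<lambda>i. \<chi> p. \<tau> (d i) (d p) / sqrt (real CARD('g))) d (\<lambda>_ _. 1) (\<lambda>\<mu>. \<Sum>\<theta>\<in>S. \<tau> \<mu> (- \<theta>))"
    (is "twisted_frame ?Y ?B ?f d ?\<sigma> ?ev")
proof -
  note c = character_labellingD[OF \<tau>]
  define r where "r = complex_of_real (sqrt (real CARD('g)))"
  have r: "r * r = of_nat CARD('g)" "r \<noteq> 0" "cnj r = r"
    by (simp_all add: r_def of_real_mult[symmetric] del: of_real_mult)
  have inj: "d i = d j \<longleftrightarrow> i = j" for i j using d by (auto simp: bij_def inj_eq)
  define f where "f = (\<lambda>i. (\<chi> p. \<tau> (d i) (d p) / r))"
  have f: "f i $ p = \<tau> (d i) (d p) / r" for i p by (simp add: f_def)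
  have sum: "(\<Sum>p\<in>UNIV. cnj (f i $ p) * (\<tau> \<nu> (d p) * z)) = (if d i = \<nu> then r * z else 0)" for i \<nu> z
  proof -
    have "(\<Sum>p\<in>UNIV. cnj (f i $ p) * (\<tau> \<nu> (d p) * z)) =
        (\<Sum>p\<in>UNIV. cnj (\<tau> (d i) (d p)) * \<tau> \<nu> (d p)) * (z / r)"
      by (simp only: f sum_distrib_right) (simp add: r(3) mult_ac)
    also have "\<dots> = (\<Sum>x\<in>UNIV. cnj (\<tau> (d i) x) * \<tau> \<nu> x) * (z / r)"
      by (subst sum.reindex_bij_betw[OF d]) simp
    also have "\<dots> = (if d i = \<nu> then r * z else 0)"
      using r by (simp add: character_orthogonality[OF \<tau>] r(1)[symmetric])
    finally show ?thesis .
  qed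
  have B: "?B (f j) $ p = ?ev (d j) * f j $ p" for j p
  proof -
    have "?B (f j) $ p = (\<Sum>x\<in>UNIV. of_bool (d p - x \<in> S) * (\<tau> (d j) x / r))"
      unfolding classical_cayley_def
      using sum.reindex_bij_betw[OF d, of "\<lambda>x. of_bool (d p - x \<in> S) * (\<tau> (d j) x / r)"]
      by (simp add: f)
    also have "\<dots> = (\<Sum>\<theta>\<in>UNIV. of_bool (\<theta> \<in> S) * (\<tau> (d j) (d p - \<theta>) / r))"
      by (rule sum.reindex_bij_witness[of _ "\<lambda>\<theta>. d p - \<theta>" "\<lambda>x. d p - x"]) simp_all
    also have "\<dots> = (\<Sum>\<theta>\<in>S. \<tau> (d j) (d p - \<theta>) / r)"
      by (rule sum.mono_neutral_cong_right) auto
    also have "\<dots> = ?ev (d j) * f j $ p"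
      unfolding f sum_distrib_right using c(1)[of "d j" "d p"]
      by (intro sum.cong) (simp_all add: diff_conv_add_uminus mult.commute del: add_uminus_conv_diff)
    finally show ?thesis .
  qed
  have "orthonormal_basis ?Y f"
  proof (rule orthonormal_combinations(2))
    fix i j
    have "qinner ?Y (f i) (f j) = (\<Sum>p\<in>UNIV. cnj (f i $ p) * (\<tau> (d j) (d p) * (1 / r)))"
      by (simp add: function_qset_inner f)
    then show "qinner ?Y (f i) (f j) = (if i = j then 1 else 0)"
      using r(2) by (simp only: sum inj) simp
  qed (simp_all add: function_qset_inner distrib_left sum.distrib sum_distrib_left mult_ac)
  moreover have "qinner ?Y (f k) (qmult ?Y (f i) (f j)) = (if d k = d i + d j then 1 / r else 0)"
    for k i j
  proof -
    have "qinner ?Y (f k) (qmult ?Y (f i) (f j)) =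
        (\<Sum>p\<in>UNIV. cnj (f k $ p) * (\<tau> (d i + d j) (d p) * (1 / (r * r))))"
      by (simp add: function_qset_inner function_qset_nth f c(2))
    then show ?thesis using r(2) by (simp only: sum) simp
  qed
  moreover have "qinner ?Y (f i) (qone ?Y) = (if d i = 0 then r else 0)" for i
  proof -
    have "qinner ?Y (f i) (qone ?Y) = (\<Sum>p\<in>UNIV. cnj (f i $ p) * (\<tau> 0 (d p) * 1))"
      by (simp add: function_qset_inner function_qset_nth f c(5))
    then show ?thesis by (simp only: sum) simp
  qed
  moreover have "star_matrix ?Y f j i = (if d j = - d i then 1 else 0)" for i j
  proof -
    have "star_matrix ?Y f j i = (\<Sum>p\<in>UNIV. cnj (f j $ p) * (\<tau> (- d i) (d p) * (1 / r)))"
      by (simp add: star_matrix_def function_qset_inner function_qset_nth f c(6) r(3))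
    then show ?thesis using r(2) by (simp only: sum) simp
  qed
  moreover have "qinner ?Y (f i) (?B (f j)) = (if i = j then ?ev (d i) else 0)" for i j
  proof -
    have "qinner ?Y (f i) (?B (f j)) =
        (\<Sum>p\<in>UNIV. cnj (f i $ p) * (\<tau> (d j) (d p) * (?ev (d j) / r)))"
      unfolding function_qset_inner B by (simp add: f mult_ac)
    then show ?thesis using r(2) by (simp only: sum inj) simp
  qed
  ultimately have "twisted_frame ?Y ?B f d ?\<sigma> ?ev"
    using d by (simp add: twisted_frame_def unitary_bicharacter_def r_def)
  then show ?thesis by (simp only: f_def r_def)
qed


section \<open>Matrix bases multiplying like a twisted group algebra\<close>

definition twisted_unitary_basis ::
    "('g::ab_group_add \<Rightarrow> 'g \<Rightarrow> complex) \<Rightarrow> ('g \<Rightarrow> complex ^ (2 \<times> 2)) \<Rightarrow> bool" where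
  "twisted_unitary_basis \<sigma> t \<longleftrightarrow>
     (\<forall>\<mu> \<nu>. qmult M2 (t \<mu>) (t \<nu>) = cnj (\<sigma> \<mu> \<nu>) *s t (\<mu> + \<nu>)) \<and>
     (\<forall>\<mu>. qstar M2 (t \<mu>) = \<sigma> \<mu> (- \<mu>) *s t (- \<mu>)) \<and>
     t 0 = qone M2 \<and> (\<forall>\<mu>. qcounit M2 (t \<mu>) = (if \<mu> = 0 then 4 else 0))"

lemma twisted_unitary_basisD:
  assumes "twisted_unitary_basis \<sigma> t"
  shows "qmult M2 (t \<mu>) (t \<nu>) = cnj (\<sigma> \<mu> \<nu>) *s t (\<mu> + \<nu>)"
    "qstar M2 (t \<mu>) = \<sigma> \<mu> (- \<mu>) *s t (- \<mu>)"
    "t 0 = qone M2" "qcounit M2 (t \<mu>) = (if \<mu> = 0 then 4 else 0)"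
  using assms unfolding twisted_unitary_basis_def by blast+

lemma twisted_unitary_basis_inner:
  assumes \<sigma>: "unitary_bicharacter \<sigma>" and t: "twisted_unitary_basis \<sigma> t"
  shows "qinner M2 (t \<mu>) (t \<nu>) = (if \<mu> = \<nu> then 4 else 0)"
proof -
  have "qcounit M2 (c *s x) = c * qcounit M2 x" for c x
    by (simp add: M2_counit sum_distrib_left mult_ac)
  then have "qinner M2 (t \<mu>) (t \<nu>) = \<sigma> \<mu> (- \<mu>) * (cnj (\<sigma> (- \<mu>) \<nu>) * (if \<nu> = \<mu> then 4 else 0))"
    by (simp add: qinner_def twisted_unitary_basisD[OF t] M2_mult_scale_left add.commute
        flip: diff_conv_add_uminus)
  moreover have "\<sigma> \<mu> (- \<mu>) * cnj (\<sigma> (- \<mu>) \<mu>) = 1"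
    using unitary_bicharacterD(4)[OF \<sigma>, of \<mu> \<mu>] by (simp add: unitary_bicharacterD(7,8)[OF \<sigma>])
  ultimately show ?thesis by (auto simp: mult.assoc[symmetric])
qed

text \<open>The norm of \<open>t \<mu>\<close> in \<open>l\<^sup>2\<close> is the square root of the order \<open>4\<close> of the group, whence the factor \<open>1 / 2\<close>.\<close>

lemma twisted_unitary_basis_frame:
  fixes \<sigma> :: "2 \<times> 2 \<Rightarrow> 2 \<times> 2 \<Rightarrow> complex"
  assumes \<sigma>: "unitary_bicharacter \<sigma>" and t: "twisted_unitary_basis \<sigma> t"
    and A: "\<And>\<mu>. A ((1 / 2) *s t \<mu>) = (ev \<mu> / 2) *s t \<mu>"
  shows "twisted_frame M2 A (\<lambda>\<mu>. (1 / 2) *s t \<mu>) id \<sigma> ev"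
    and "bij (\<lambda>x. \<Sum>\<mu>\<in>UNIV. x $ \<mu> *s t \<mu>)"
proof -
  let ?e = "\<lambda>\<mu>. (1 / 2 :: complex) *s t \<mu>"
  have inner_left: "qinner M2 (c *s x) y = cnj c * qinner M2 x y" for c x y
    by (simp add: M2_inner sum_distrib_left mult_ac)
  have t_nu: "t \<nu> = 2 *s ?e \<nu>" for \<nu> by simp
  have inner: "qinner M2 (?e \<mu>) (z *s t \<nu>) = (if \<mu> = \<nu> then 2 * z else 0)" for \<mu> \<nu> z
    by (simp add: inner_left M2_inner_scale twisted_unitary_basis_inner[OF \<sigma> t])
  have orth: "qinner M2 (?e \<mu>) (?e \<nu>) = (if \<mu> = \<nu> then 1 else 0)" for \<mu> \<nu>
    by (simp add: inner)
  note comb = orthonormal_combinations[of M2 ?e, OF M2_inner_add M2_inner_scale orth]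
  have "bij (\<lambda>c :: complex ^ (2 \<times> 2). 2 *s c)"
    by (rule bij_betw_byWitness[where f' = "\<lambda>c. (1 / 2) *s c"]) auto
  then have "bij ((\<lambda>c. \<Sum>\<mu>\<in>UNIV. c $ \<mu> *s ?e \<mu>) \<circ> (\<lambda>c. 2 *s c))"
    using comb(1) by (rule bij_comp)
  then show "bij (\<lambda>x. \<Sum>\<mu>\<in>UNIV. x $ \<mu> *s t \<mu>)" by (simp add: comp_def)
  have sqrt4: "sqrt 4 = 2" using real_sqrt_abs[of 2] by simp
  have "qinner M2 (?e k) (qmult M2 (?e i) (?e j)) =
      (if k = i + j then cnj (\<sigma> i j) / 2 else 0)" for k i j
  proof -
    have "qmult M2 (?e i) (?e j) = (cnj (\<sigma> i j) / 4) *s t (i + j)"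
      by (simp add: M2_mult_scale_left M2_mult_scale_right twisted_unitary_basisD[OF t])
    then show ?thesis by (simp add: inner)
  qed
  moreover have "qinner M2 (?e i) (qone M2) = (if i = 0 then 2 else 0)" for i
    using inner[of i 1 0] by (simp add: twisted_unitary_basisD[OF t])
  moreover have "star_matrix M2 ?e j i = (if j = - i then \<sigma> i (- i) else 0)" for i j
  proof -
    have "qstar M2 (?e i) = (\<sigma> i (- i) / 2) *s t (- i)"
      by (simp add: M2_star_scale twisted_unitary_basisD[OF t])
    then show ?thesis by (simp add: star_matrix_def inner)
  qed
  moreover have "qinner M2 (?e i) (A (?e j)) = (if i = j then ev i else 0)" for i j
    by (simp add: A inner)
  ultimately show "twisted_frame M2 A ?e id \<sigma> ev"
    using comb(2) \<sigma> by (simp add: twisted_frame_def sqrt4)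
qed

lemma qgraph_isomorphic_sym:
  assumes "qgraph_isomorphic X A Y B" shows "qgraph_isomorphic Y B X A"
proof -
  obtain \<phi> where \<phi>: "Vector_Spaces.linear (*s) (*s) \<phi>" "bij \<phi>"
      "\<And>x y. \<phi> (qmult X x y) = qmult Y (\<phi> x) (\<phi> y)" "\<And>x. \<phi> (qstar X x) = qstar Y (\<phi> x)"
      "\<phi> \<circ> A = B \<circ> \<phi>"
    using assms by (auto simp: qgraph_isomorphic_def)
  let ?\<psi> = "inv \<phi>"
  have [simp]: "?\<psi> (\<phi> x) = x" "\<phi> (?\<psi> y) = y" for x y
    using \<phi>(2) by (simp_all add: bij_is_inj bij_is_surj surj_f_inv_f)
  have eqI: "?\<psi> y = x" if "y = \<phi> x" for x y using that by simp
  interpret Vector_Spaces.linear "(*s)" "(*s)" \<phi> by (rule \<phi>(1))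
  have "Vector_Spaces.linear (*s) (*s) ?\<psi>"
    by unfold_locales (auto intro!: eqI simp: add scale vec.scale_right_distrib vec.scale_left_distrib)
  moreover have "?\<psi> (qmult Y x y) = qmult X (?\<psi> x) (?\<psi> y)" "?\<psi> (qstar Y x) = qstar X (?\<psi> x)" for x y
    by (auto intro!: eqI simp: \<phi>)
  moreover have "?\<psi> \<circ> B = A \<circ> ?\<psi>"
  proof
    fix y
    show "(?\<psi> \<circ> B) y = (A \<circ> ?\<psi>) y"
      using fun_cong[OF \<phi>(5), of "?\<psi> y"] by (auto intro!: eqI)
  qed
  ultimately show ?thesis using bij_imp_bij_inv[OF \<phi>(2)] unfolding qgraph_isomorphic_def by blast
qed

text \<open>The isomorphism is constructed in the direction from the twisted dual to \<open>M\<^sub>2\<close>, where it is given on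
  the basis by \<open>t\<close>.\<close>

lemma twisted_unitary_basis_isomorphism:
  fixes \<sigma> :: "2 \<times> 2 \<Rightarrow> 2 \<times> 2 \<Rightarrow> complex"
  assumes \<sigma>: "unitary_bicharacter \<sigma>" and t: "twisted_unitary_basis \<sigma> t"
    and A: "Vector_Spaces.linear (*s) (*s) A"
    and eigen: "\<And>\<mu>. A (t \<mu>) = (\<Sum>\<theta>\<in>S. \<tau> \<mu> (- \<theta>)) *s t \<mu>"
  shows "qgraph_isomorphic M2 A (twisted_dual \<sigma>) (cayley_adjacency \<tau> S)"
proof (rule qgraph_isomorphic_sym)
  let ?\<psi> = "\<lambda>x. \<Sum>\<mu>\<in>UNIV. x $ \<mu> *s t \<mu>"
  interpret A: Vector_Spaces.linear "(*s)" "(*s)" A by (rule A)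
  have lin: "Vector_Spaces.linear (*s) (*s) ?\<psi>"
    by unfold_locales (simp_all add: vec.scale_left_distrib vec.scale_right_distrib sum.distrib vec.scale_sum_right)
  then interpret Vector_Spaces.linear "(*s)" "(*s)" ?\<psi> .
  have \<psi>_axis: "?\<psi> (axis \<mu> 1) = t \<mu>" for \<mu>
    by (simp add: axis_def if_distrib[where f = "\<lambda>c. c *s _"] cong: if_cong)
  have "?\<psi> (qmult (twisted_dual \<sigma>) x y) = qmult M2 (?\<psi> x) (?\<psi> y)" for x y
  proof -
    have "?\<psi> (qmult (twisted_dual \<sigma>) x y) =
        (\<Sum>\<mu>\<in>UNIV. \<Sum>\<nu>\<in>UNIV. (x $ \<mu> * y $ \<nu> * cnj (\<sigma> \<mu> \<nu>)) *s t (\<mu> + \<nu>))"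
      unfolding twisted_dual_def qset.simps sum scale \<psi>_axis ..
    also have "\<dots> = qmult M2 (?\<psi> x) (?\<psi> y)"
      by (simp add: M2_mult_sum_left M2_mult_sum_right M2_mult_scale_left
          M2_mult_scale_right twisted_unitary_basisD[OF t] vec.scale_sum_right mult_ac)
         (rule sum.swap)
    finally show ?thesis .
  qed
  moreover have "?\<psi> (qstar (twisted_dual \<sigma>) x) = qstar M2 (?\<psi> x)" for x
  proof -
    have "?\<psi> (qstar (twisted_dual \<sigma>) x) = (\<Sum>\<mu>\<in>UNIV. (cnj (x $ \<mu>) * \<sigma> \<mu> (- \<mu>)) *s t (- \<mu>))"
      unfolding twisted_dual_def qset.simps sum scale \<psi>_axis ..
    also have "\<dots> = qstar M2 (?\<psi> x)"
      by (simp add: M2_star_sum M2_star_scale twisted_unitary_basisD[OF t])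
    finally show ?thesis .
  qed
  moreover have "?\<psi> \<circ> cayley_adjacency \<tau> S = A \<circ> ?\<psi>"
    by (simp add: fun_eq_iff cayley_adjacency_def A.sum A.scale eigen mult.commute)
  moreover have "bij ?\<psi>"
    by (rule twisted_unitary_basis_frame(2)[OF \<sigma> t, of A "\<lambda>\<mu>. \<Sum>\<theta>\<in>S. \<tau> \<mu> (- \<theta>)"])
       (simp add: A.scale eigen)
  ultimately show "qgraph_isomorphic (twisted_dual \<sigma>) (cayley_adjacency \<tau> S) M2 A"
    using lin unfolding qgraph_isomorphic_def by blast
qed


section \<open>Sign characters of the Klein four-group\<close>

definition sign2 :: "2 \<Rightarrow> complex" where
  "sign2 x = (if x = 0 then 1 else - 1)"

lemma cases_2: "(x :: 2) = 0 \<or> x = 1"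
  using exhaust_2[of x] by auto

lemma sign2_add: "sign2 (x + y) = sign2 x * sign2 y"
  using cases_2[of x] cases_2[of y] by (auto simp: sign2_def)

lemma sign2_inject: "sign2 x = sign2 y \<longleftrightarrow> x = y"
  using cases_2[of x] cases_2[of y] by (auto simp: sign2_def)

text \<open>The four characters of the Klein four-group, given by the standard pairing over the field with two
  elements.\<close>

definition klein_sign :: "2 \<times> 2 \<Rightarrow> 2 \<times> 2 \<Rightarrow> complex" where
  "klein_sign \<alpha> \<mu> = sign2 (fst \<alpha> * fst \<mu> + snd \<alpha> * snd \<mu>)"

lemma klein_sign_add: "klein_sign \<alpha> (\<mu> + \<nu>) = klein_sign \<alpha> \<mu> * klein_sign \<alpha> \<nu>"
  by (simp add: klein_sign_def sign2_add[symmetric] algebra_simps)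

lemma klein_sign_inject: "(\<forall>\<mu>. klein_sign \<alpha> \<mu> = klein_sign \<beta> \<mu>) \<longleftrightarrow> \<alpha> = \<beta>"
proof
  assume *: "\<forall>\<mu>. klein_sign \<alpha> \<mu> = klein_sign \<beta> \<mu>"
  show "\<alpha> = \<beta>"
    using *[rule_format, of "(1, 0)"] *[rule_format, of "(0, 1)"]
    by (simp add: klein_sign_def sign2_inject prod_eq_iff)
qed simp

text \<open>For fixed \<open>\<theta>\<close>, the map \<open>\<mu> \<mapsto> \<tau>\<^sub>\<mu>(\<theta>)\<close> is a sign character. Characters separate points, so distinct
  \<open>\<theta>\<close> give distinct sign characters; there are four of each, so all of them occur.\<close>

lemma character_labelling_klein_sign:
  fixes \<tau> :: "2 \<times> 2 \<Rightarrow> 2 \<times> 2 \<Rightarrow> complex"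
  assumes \<tau>: "character_labelling \<tau>"
  shows "\<exists>\<theta>. \<forall>\<mu>. \<tau> \<mu> \<theta> = klein_sign \<alpha> \<mu>"
proof -
  note c = character_labellingD[OF \<tau>]
  have dbl: "x + x = 0" for x :: "2 \<times> 2"
    using cases_2[of "fst x"] cases_2[of "snd x"] by (auto simp: prod_eq_iff)
  have pm: "\<tau> \<mu> x = 1 \<or> \<tau> \<mu> x = - 1" for \<mu> x
    using c(2)[of \<mu> \<mu> x] c(5)[of x] dbl[of \<mu>] by (metis square_eq_1_iff)
  define bit :: "complex \<Rightarrow> 2" where "bit z = (if z = 1 then 0 else 1)" for z
  have sign_bit: "sign2 (bit (\<tau> \<mu> x)) = \<tau> \<mu> x" for \<mu> x
    using pm[of \<mu> x] by (auto simp: sign2_def bit_def)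
  \<comment> \<open>A sign character is determined by its values on the two generators.\<close>
  let ?f = "\<lambda>x. (bit (\<tau> (1, 0) x), bit (\<tau> (0, 1) x))"
  have \<tau>_f: "\<tau> \<mu> x = klein_sign (?f x) \<mu>" for \<mu> x
  proof -
    obtain a b where \<mu>: "\<mu> = (a, b)" by (cases \<mu>)
    have ab: "\<tau> (a, b) x = \<tau> (a, 0) x * \<tau> (0, b) x"
      using c(2)[of "(a, 0)" "(0, b)" x] by simp
    have "\<tau> (a, 0) x = sign2 (bit (\<tau> (1, 0) x) * a)" "\<tau> (0, b) x = sign2 (bit (\<tau> (0, 1) x) * b)"
      using cases_2[of a] cases_2[of b] c(5)[of x]
      by (auto simp: sign_bit zero_prod_def) (simp_all add: sign2_def)
    then show ?thesis by (simp add: \<mu> ab klein_sign_def sign2_add)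
  qed
  have "inj ?f"
  proof (rule injI)
    fix x y assume "?f x = ?f y"
    then have eq: "\<tau> \<mu> x = \<tau> \<mu> y" for \<mu>
      using \<tau>_f[of \<mu> x] \<tau>_f[of \<mu> y] by (simp only:)
    have "klein_sign \<beta> x = klein_sign \<beta> y" for \<beta>
    proof -
      have "norm (klein_sign \<beta> z) = 1" for z by (simp add: klein_sign_def sign2_def)
      then have "klein_sign \<beta> \<in> {f. (\<forall>x. norm (f x) = 1) \<and> (\<forall>x y. f (x + y) = f x * f y)}"
        using klein_sign_add by blast
      then have "klein_sign \<beta> \<in> range \<tau>"
        using \<tau> unfolding character_labelling_def bij_betw_def by blast
      then show ?thesis using eq by auto
    qed
    then have "klein_sign x \<beta> = klein_sign y \<beta>" for \<beta> by (simp add: klein_sign_def mult.commute)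
    then show "x = y" using klein_sign_inject by blast
  qed
  then have "surj ?f" by (simp add: finite_UNIV_inj_surj)
  then obtain \<theta> where "\<alpha> = ?f \<theta>" using surjD[of ?f \<alpha>] by blast
  then have "\<tau> \<mu> \<theta> = klein_sign \<alpha> \<mu>" for \<mu> using \<tau>_f[of \<mu> \<theta>] by (simp only:)
  then show ?thesis by blast
qed

text \<open>This bicharacter is \<open>-1\<close> on \<open>((1, 0), (0, 1))\<close> and \<open>1\<close> on the reversed pair, so \<open>t\<^bsub>(1, 0)\<^esub>\<close> and \<open>t\<^bsub>(0, 1)\<^esub>\<close>
  anticommute in the corresponding twisted dual.\<close>


section \<open>Anticommuting pairs of matrices\<close>

definition klein_cocycle :: "2 \<times> 2 \<Rightarrow> 2 \<times> 2 \<Rightarrow> complex" where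
  "klein_cocycle \<mu> \<nu> = sign2 (fst \<mu> * snd \<nu>)"

lemma unitary_bicharacter_klein_cocycle: "unitary_bicharacter klein_cocycle"
  by (simp add: unitary_bicharacter_def klein_cocycle_def sign2_add[symmetric] algebra_simps)
     (simp add: sign2_def)

text \<open>The four products \<open>1, x, y, y x\<close> of an anticommuting pair. With the factors in the order \<open>y x\<close>, no
  sign arises in \<open>t\<^bsub>(0, 1)\<^esub> t\<^bsub>(1, 0)\<^esub> = t\<^bsub>(1, 1)\<^esub>\<close>, in agreement with the cocycle.\<close>

definition clifford_basis :: "complex ^ (2 \<times> 2) \<Rightarrow> complex ^ (2 \<times> 2) \<Rightarrow> 2 \<times> 2 \<Rightarrow> complex ^ (2 \<times> 2)" where
  "clifford_basis x y \<mu> =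
     qmult M2 (if snd \<mu> = 1 then y else qone M2) (if fst \<mu> = 1 then x else qone M2)"

lemma pauli_square: "norm v = 1 \<Longrightarrow> qmult M2 (pauli v) (pauli v) = qone M2"
  using pauli_mult_anticommute[of v v]
  by (simp add: dot_square_norm) (simp add: vec_eq_iff)

lemma pauli_anticommute:
  "v \<bullet> w = 0 \<Longrightarrow> qmult M2 (pauli v) (pauli w) = (- 1) *s qmult M2 (pauli w) (pauli v)"
  using pauli_mult_anticommute[of v w] by (simp add: eq_neg_iff_add_eq_0)

lemma all_klein: "(\<forall>\<mu> :: 2 \<times> 2. P \<mu>) \<longleftrightarrow> P (0, 0) \<and> P (1, 0) \<and> P (0, 1) \<and> P (1, 1)"
  using cases_2 by (simp add: split_paired_All) metis

text \<open>Anticommutation brings a product of two of the four elements into the order \<open>y x\<close> at the cost of the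
  sign recorded by the cocycle. The trace of \<open>y x\<close> is twice the inner product of the two vectors, so it vanishes.\<close>

lemma twisted_unitary_basis_clifford:
  assumes v: "norm v = 1" and w: "norm w = 1" and vw: "v \<bullet> w = 0"
  shows "twisted_unitary_basis klein_cocycle (clifford_basis (pauli v) (pauli w))"
proof -
  let ?x = "pauli v" and ?y = "pauli w"
  note simps = M2_mult_minus M2_mult_assoc M2_mult_one
    M2_star_mult M2_star_one pauli_star vector_smult_assoc vector_smult_lid
  have sq: "qmult M2 ?x ?x = qone M2" "qmult M2 ?y ?y = qone M2"
    using v w by (simp_all add: pauli_square)
  have sq': "qmult M2 ?x (qmult M2 ?x z) = z" "qmult M2 ?y (qmult M2 ?y z) = z" for z
    by (simp_all add: M2_mult_assoc[symmetric] sq M2_mult_one)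
  have anti: "qmult M2 ?x ?y = - qmult M2 ?y ?x" using pauli_anticommute[OF vw] by simp
  have anti': "qmult M2 ?x (qmult M2 ?y z) = - qmult M2 ?y (qmult M2 ?x z)" for z
    unfolding M2_mult_assoc[symmetric] anti by (simp add: M2_mult_minus)
  have counit_one: "qcounit M2 (qone M2) = 4" by (simp add: M2_counit M2_nth)
  have counit: "qcounit M2 (pauli v) = 0" for v by (simp add: M2_counit sum_2 pauli_nth)
  have counit_yx: "qcounit M2 (qmult M2 ?y ?x) = 0"
    using pauli_inner[of w v] vw by (simp add: qinner_def pauli_star inner_commute)
  show ?thesis
    unfolding twisted_unitary_basis_def all_klein
    by (simp add: clifford_basis_def klein_cocycle_def sign2_def zero_prod_def simps sq sq' anti anti'
        counit_one counit counit_yx)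
qed

lemma clifford_basis_conjugate:
  assumes x: "qmult M2 u x = a *s qmult M2 x u" and y: "qmult M2 u y = b *s qmult M2 y u"
    and u: "qmult M2 u u = qone M2"
  shows "qmult M2 (qmult M2 u (clifford_basis x y \<mu>)) u =
    ((if snd \<mu> = 1 then b else 1) * (if fst \<mu> = 1 then a else 1)) *s clifford_basis x y \<mu>"
proof -
  have x': "qmult M2 u (qmult M2 x z) = a *s qmult M2 x (qmult M2 u z)" for z
    unfolding M2_mult_assoc[symmetric] x by (simp add: M2_mult_scale_left)
  have y': "qmult M2 u (qmult M2 y z) = b *s qmult M2 y (qmult M2 u z)" for z
    unfolding M2_mult_assoc[symmetric] y by (simp add: M2_mult_scale_left)
  show ?thesis
    by (simp add: clifford_basis_def M2_mult_assoc M2_mult_one x' y' u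
        M2_mult_scale_right mult.commute)
qed


section \<open>Simple quantum graphs on two-by-two matrices\<close>

text \<open>Both parts use the same basis \<open>t\<close> of \<open>M\<^sub>2\<close> and the same set \<open>S\<close>; for the second, the classical graph is
  the untwisted Cayley graph of \<open>S\<close>, whose eigenvalues agree with those of \<open>A\<close>.\<close>

theorem proposition8p1:
  fixes \<tau> :: "2 \<times> 2 \<Rightarrow> 2 \<times> 2 \<Rightarrow> complex"
    and A :: "complex ^ (2 \<times> 2) \<Rightarrow> complex ^ (2 \<times> 2)"
  assumes "character_labelling \<tau>"
    and "simple_quantum_graph M2 A"
  shows "(\<exists>\<sigma> S. unitary_bicharacter \<sigma> \<and>
            qgraph_isomorphic M2 A (twisted_dual \<sigma>) (cayley_adjacency \<tau> S)) \<and>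
         (\<exists>(Y :: 4 qset) B. quantum_graph Y B \<and> classical Y \<and> quantum_isomorphic M2 A Y B)"
proof -
  obtain B K where B: "finite B" "card B = 3" "pairwise orthogonal B" "\<forall>v\<in>B. norm v = 1"
    and K: "K \<subseteq> B" and A: "A = (\<lambda>x. \<Sum>v\<in>K. qmult M2 (qmult M2 (pauli v) x) (pauli v))"
    by (rule simple_quantum_graph_M2_pauli_form[OF assms(2)])
  obtain v1 v2 v3 where v: "B = {v1, v2, v3}" "v1 \<noteq> v2" "v1 \<noteq> v3" "v2 \<noteq> v3"
    using B(2) by (auto simp: card_3_iff)
  have orth: "v \<bullet> w = 0" if "v \<in> B" "w \<in> B" "v \<noteq> w" for v w
    using B(3) that by (auto simp: pairwise_def orthogonal_def)
  define t where "t = clifford_basis (pauli v1) (pauli v2)"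
  have \<sigma>: "unitary_bicharacter klein_cocycle" by (rule unitary_bicharacter_klein_cocycle)
  have t: "twisted_unitary_basis klein_cocycle t"
    unfolding t_def using B(4) orth v by (intro twisted_unitary_basis_clifford) auto
  \<comment> \<open>The character by which conjugation acts: \<open>V\<^sub>1 = t\<^bsub>(1, 0)\<^esub>\<close> changes the sign of \<open>V\<^sub>2\<close> and fixes itself,
    \<open>V\<^sub>2 = t\<^bsub>(0, 1)\<^esub>\<close> does the opposite, and \<open>V\<^sub>3\<close> changes the sign of both.\<close>
  define \<alpha> :: "real ^ 3 \<Rightarrow> 2 \<times> 2" where
    "\<alpha> v = (if v = v1 then (0, 1) else if v = v2 then (1, 0) else (1, 1))" for v
  have conj: "qmult M2 (qmult M2 (pauli v) (t \<mu>)) (pauli v) = klein_sign (\<alpha> v) \<mu> *s t \<mu>"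
    if "v \<in> B" for v \<mu>
  proof -
    have comm: "qmult M2 (pauli v) (pauli w) = (if v = w then 1 else - 1) *s qmult M2 (pauli w) (pauli v)"
      if "w \<in> B" for w
      using pauli_anticommute[OF orth, of v w] \<open>v \<in> B\<close> that by auto
    have "qmult M2 (qmult M2 (pauli v) (t \<mu>)) (pauli v) =
        ((if snd \<mu> = 1 then if v = v2 then 1 else - 1 else 1) *
         (if fst \<mu> = 1 then if v = v1 then 1 else - 1 else 1)) *s t \<mu>"
      unfolding t_def
      by (rule clifford_basis_conjugate[OF comm comm pauli_square]) (use B(4) that v(1) in auto)
    also have "((if snd \<mu> = 1 then if v = v2 then 1 else - 1 else 1) *
         (if fst \<mu> = 1 then if v = v1 then 1 else - 1 else 1)) = klein_sign (\<alpha> v) \<mu>"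
      using v that cases_2[of "fst \<mu>"] cases_2[of "snd \<mu>"]
      by (auto simp: \<alpha>_def klein_sign_def sign2_def)
    finally show ?thesis .
  qed
  obtain \<theta> where \<theta>: "\<And>\<beta> \<mu>. \<tau> \<mu> (\<theta> \<beta>) = klein_sign \<beta> \<mu>"
    using character_labelling_klein_sign[OF assms(1)] by metis
  define S where "S = (\<lambda>v. - \<theta> (\<alpha> v)) ` K"
  have "inj_on (\<lambda>v. - \<theta> (\<alpha> v)) K"
  proof (rule inj_onI)
    fix v w assume vw: "v \<in> K" "w \<in> K" and "- \<theta> (\<alpha> v) = - \<theta> (\<alpha> w)"
    then have "\<theta> (\<alpha> v) = \<theta> (\<alpha> w)" by simp
    then have "\<alpha> v = \<alpha> w" using \<theta> klein_sign_inject by metis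
    then show "v = w" using vw K v by (auto simp: \<alpha>_def split: if_splits)
  qed
  then have ev: "(\<Sum>\<theta>\<in>S. \<tau> \<mu> (- \<theta>)) = (\<Sum>v\<in>K. klein_sign (\<alpha> v) \<mu>)" for \<mu>
    unfolding S_def by (simp add: sum.reindex \<theta>)
  have eigen: "A (t \<mu>) = (\<Sum>\<theta>\<in>S. \<tau> \<mu> (- \<theta>)) *s t \<mu>" for \<mu>
  proof -
    have "A (t \<mu>) = (\<Sum>v\<in>K. klein_sign (\<alpha> v) \<mu> *s t \<mu>)"
      unfolding A by (intro sum.cong refl conj) (use K in blast)
    then show ?thesis by (simp add: ev vec.scale_sum_left)
  qed
  have lin: "Vector_Spaces.linear (*s) (*s) A"
    unfolding A
    by unfold_locales (simp_all add: vec.scale_left_distrib vec.scale_right_distrib M2_mult_add_left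
        M2_mult_add_right M2_mult_scale_left M2_mult_scale_right sum.distrib vec.scale_sum_right)
  have "qgraph_isomorphic M2 A (twisted_dual klein_cocycle) (cayley_adjacency \<tau> S)"
    using \<sigma> t lin eigen by (rule twisted_unitary_basis_isomorphism)
  moreover have "\<exists>(Y :: 4 qset) B. quantum_graph Y B \<and> classical Y \<and> quantum_isomorphic M2 A Y B"
  proof -
    have "card (UNIV :: 4 set) = card (UNIV :: (2 \<times> 2) set)" by simp
    then obtain d :: "4 \<Rightarrow> 2 \<times> 2" where d: "bij d"
      using finite_same_card_bij[of "UNIV :: 4 set" "UNIV :: (2 \<times> 2) set"] by auto
    interpret lin: Vector_Spaces.linear "(*s)" "(*s)" A by (rule lin)
    have "twisted_frame M2 A (\<lambda>\<mu>. (1 / 2) *s t \<mu>) id klein_cocycle (\<lambda>\<mu>. \<Sum>\<theta>\<in>S. \<tau> \<mu> (- \<theta>))"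
      by (rule twisted_unitary_basis_frame(1)[OF \<sigma> t]) (simp add: lin.scale eigen)
    then have "quantum_isomorphic M2 A function_qset (classical_cayley d S)"
      using classical_cayley_frame[OF assms(1) d] by (rule quantum_isomorphic_if_twisted_frames)
    then show ?thesis using quantum_graph_classical_cayley classical_function_qset by blast
  qed
  ultimately show ?thesis using \<sigma> by blast
qed

end
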